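(* Let $(X,d,A)$ be a metric pair with $A\neq\emptyset$ and $(X,d)$ complete and separable, and let $1\le p<\infty$. Then $(\mathcal{M}_p^+(X,A),W_p)$ is a pseudometric space, and the map $X\to\mathcal{M}_p^+(X,A)$ given by $x\mapsto\delta_x$ gives an isometric embedding $(X,d_p)\to(\mathcal{M}_p^+(X,A),W_p)$, i.e. $W_p(\delta_x,\delta_y)=d_p(x,y)$ for all $x,y\in X$.
   Context: A metric pair $(X,d,A)$ is a metric space $(X,d)$ with a closed subset $A\subset X$; $d_A(x)=\inf_{a\in A}d(x,a)$. Measures take values in $[0,\infty]$. Let $\mathcal{B}^+(X)$ be the commutative monoid of Borel measures on $X$ and $\mathcal{B}^+(X,A)=\mathcal{B}^+(X)/\mathcal{B}^+(A)$ the quotient monoid: $\mu\sim\nu$ iff $\mu+\sigma=\nu+\tau$ for some Borel measures $\sigma,\tau$ concentrated on $A$; equivalently $\mu,\nu$ agree on Borel subsets of $X\setminus A$, so relative Borel measures correspond bijectively to Borel measures on $X\setminus A$ (in particular $\delta_x$ represents $0$ if $x\in A$). For $f$ vanishing on $A$, $\mu(f)=\int_X f\,d\mu$ is well defined. $\mu$ is tight if $\mu(E)=\sup\{\mu(K): K\subset E \text{ compact}\}$ for every Borel $E\subset X\setminus A$. $\mathcal{M}_p^+(X,A)$ is the set of tight $\mu\in\mathcal{B}^+(X,A)$ with $\mu(d_A^p)<\infty$. The product pair is $(X\times X,d+d,A\times A)$, with $\mathcal{B}^+(X^2,A^2)$ defined in the same way; maps of pairs (Lipschitz maps sending subset into subset)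 induce pushforwards of relative Borel measures. $\Pi(\mu,\nu)$ is the set of couplings, i.e. $\pi\in\mathcal{B}^+(X^2,A^2)$ whose pushforwards under the two projections $X^2\to X$ are $\mu$ and $\nu$. Define the pseudometric $d_p(x,y)=\min\bigl(d(x,y),(d_A(x)^p+d_A(y)^p)^{1/p}\bigr)$, which vanishes on $A\times A$. For $\varepsilon>0$ let $\mu_\varepsilon(E)=\mu(E\cap\{d_A>\varepsilon\})$ and $\mu^\varepsilon(E)=\mu(E\cap\{0<d_A\le\varepsilon\})$. Fix $a\in A$ and let $i_1^a(x)=(x,a)$, $i_2^a(x)=(a,x)$. Let $$\Pi_\varepsilon(\mu,\nu)=\{\pi\in\Pi(\mu,\nu): \exists\,\pi'\in\Pi(\mu_\varepsilon,\nu_\varepsilon)\text{ with }\pi=\pi'+(i_1^a)_*\mu^\varepsilon+(i_2^a)_*\nu^\varepsilon\}.$$ The (relative) $p$-Wasserstein distance is $W_p(\mu,\nu)=\bigl(\inf_{\varepsilon>0}\inf_{\pi\in\Pi_\varepsilon(\mu,\nu)}\pi(d_p^p)\bigr)^{1/p}$, where $\pi(d_p^p)=\int_{X^2}d_p^p\,d\pi$ (this does not depend on the choice of $a$). *)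

theory Defs
  imports "HOL-Probability.Probability"
begin

definition borel_measures :: "'a::topological_space measure set" where
  "borel_measures = {\<mu>. sets \<mu> = sets borel}"

definition add_measure :: "'a measure \<Rightarrow> 'a measure \<Rightarrow> 'a measure" where
  "add_measure \<mu> \<nu> = measure_of (space \<mu>) (sets \<mu>) (\<lambda>E. emeasure \<mu> E + emeasure \<nu> E)"

definition concentrated_on :: "'a measure \<Rightarrow> 'a set \<Rightarrow> bool" where
  "concentrated_on \<mu> A \<longleftrightarrow> emeasure \<mu> (- A) = 0"

definition rel_eq :: "'a::topological_space set \<Rightarrow> ('a measure \<times> 'a measure) set" where
  "rel_eq A = {(\<mu>, \<nu>). \<mu> \<in> borel_measures \<and> \<nu> \<in> borel_measures \<and>
     (\<exists>\<sigma>\<in>borel_measures. \<exists>\<tau>\<in>borel_measures. concentrated_on \<sigma> A \<and> concentrated_on \<tau> A \<and>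
        add_measure \<mu> \<sigma> = add_measure \<nu> \<tau>)}"

text \<open>A relative Borel measure is an equivalence class, that is, a set of Borel measures.\<close>

definition rel_measures :: "'a::topological_space set \<Rightarrow> 'a measure set set" where
  "rel_measures A = borel_measures // rel_eq A"

definition rel_class :: "'a::topological_space set \<Rightarrow> 'a measure \<Rightarrow> 'a measure set" where
  "rel_class A \<mu> = rel_eq A `` {\<mu>}"

text \<open>Operations on classes are lifted from representatives by taking the union of the resulting
  classes, respectively the common value over all representatives. The lemmas below show that this
  does not depend on representatives (for \<open>rel_emeasure\<close>: on Borel sets disjoint from \<open>A\<close>; for
  \<open>rel_integral\<close>: for Borel functions vanishing on \<open>A\<close>).\<close>

definition rel_add :: "'a::topological_space set \<Rightarrow> 'a measure set \<Rightarrow> 'a measure set \<Rightarrow> 'a measure set" where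
  "rel_add A M N = (\<Union>\<mu>\<in>M. \<Union>\<nu>\<in>N. rel_class A (add_measure \<mu> \<nu>))"

definition rel_push ::
  "'b::topological_space set \<Rightarrow> ('a::topological_space \<Rightarrow> 'b) \<Rightarrow> 'a measure set \<Rightarrow> 'b measure set" where
  "rel_push B f M = (\<Union>\<mu>\<in>M. rel_class B (distr \<mu> borel f))"

text \<open>\<open>density \<mu> (indicator S)\<close> is the Borel measure \<open>E \<mapsto> \<mu>(E \<inter> S)\<close> on the whole space.\<close>

definition rel_restrict :: "'a::topological_space set \<Rightarrow> 'a set \<Rightarrow> 'a measure set \<Rightarrow> 'a measure set" where
  "rel_restrict A S M = (\<Union>\<mu>\<in>M. rel_class A (density \<mu> (indicator S)))"

definition rel_emeasure :: "'a measure set \<Rightarrow> 'a set \<Rightarrow> ennreal" where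
  "rel_emeasure M E = the_elem ((\<lambda>\<mu>. emeasure \<mu> E) ` M)"

definition rel_integral :: "'a measure set \<Rightarrow> ('a \<Rightarrow> ennreal) \<Rightarrow> ennreal" where
  "rel_integral M f = the_elem ((\<lambda>\<mu>. \<integral>\<^sup>+x. f x \<partial>\<mu>) ` M)"

definition rel_dirac :: "'a::topological_space set \<Rightarrow> 'a \<Rightarrow> 'a measure set" where
  "rel_dirac A x = rel_class A (return borel x)"

definition rel_tight :: "'a::topological_space set \<Rightarrow> 'a measure set \<Rightarrow> bool" where
  "rel_tight A M \<longleftrightarrow>
     (\<forall>E\<in>sets borel. E \<subseteq> - A \<longrightarrow> rel_emeasure M E = (SUP K\<in>{K. compact K \<and> K \<subseteq> E}. rel_emeasure M K))"

definition Mp :: "real \<Rightarrow> 'a::metric_space set \<Rightarrow> 'a measure set set" where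
  "Mp p A = {M \<in> rel_measures A. rel_tight A M \<and>
     rel_integral M (\<lambda>x. ennreal (infdist x A powr p)) < \<top>}"

text \<open>The Euclidean product metric of the type \<open>'a \<times> 'a\<close> induces the same topology as the sum
  metric, and only the Borel sets of the product enter the definitions below.\<close>

definition couplings ::
  "'a::metric_space set \<Rightarrow> 'a measure set \<Rightarrow> 'a measure set \<Rightarrow> ('a \<times> 'a) measure set set" where
  "couplings A M N = {P \<in> rel_measures (A \<times> A). rel_push A fst P = M \<and> rel_push A snd P = N}"

definition dp :: "real \<Rightarrow> 'a::metric_space set \<Rightarrow> 'a \<Rightarrow> 'a \<Rightarrow> real" where
  "dp p A x y = min (dist x y) ((infdist x A powr p + infdist y A powr p) powr (1 / p))"

definition far_part :: "'a::metric_space set \<Rightarrow> real \<Rightarrow> 'a measure set \<Rightarrow> 'a measure set" where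
  "far_part A \<epsilon> M = rel_restrict A {x. infdist x A > \<epsilon>} M"

definition near_part :: "'a::metric_space set \<Rightarrow> real \<Rightarrow> 'a measure set \<Rightarrow> 'a measure set" where
  "near_part A \<epsilon> M = rel_restrict A {x. 0 < infdist x A \<and> infdist x A \<le> \<epsilon>} M"

definition eps_couplings ::
  "'a::metric_space set \<Rightarrow> 'a \<Rightarrow> real \<Rightarrow> 'a measure set \<Rightarrow> 'a measure set \<Rightarrow> ('a \<times> 'a) measure set set" where
  "eps_couplings A a \<epsilon> M N = {P \<in> couplings A M N.
     \<exists>P'\<in>couplings A (far_part A \<epsilon> M) (far_part A \<epsilon> N).
       P = rel_add (A \<times> A)
             (rel_add (A \<times> A) P' (rel_push (A \<times> A) (\<lambda>x. (x, a)) (near_part A \<epsilon> M)))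
             (rel_push (A \<times> A) (\<lambda>x. (a, x)) (near_part A \<epsilon> N))}"

definition ennreal_root :: "real \<Rightarrow> ennreal \<Rightarrow> ennreal" where
  "ennreal_root p c = (if c = \<top> then \<top> else ennreal (enn2real c powr (1 / p)))"

definition Wp :: "real \<Rightarrow> 'a::metric_space set \<Rightarrow> 'a \<Rightarrow> 'a measure set \<Rightarrow> 'a measure set \<Rightarrow> ennreal" where
  "Wp p A a M N = ennreal_root p
     (INF \<epsilon>\<in>{0<..}. INF P\<in>eps_couplings A a \<epsilon> M N.
        rel_integral P (\<lambda>(x, y). ennreal (dp p A x y powr p)))"

definition pseudometric_on :: "'b set \<Rightarrow> ('b \<Rightarrow> 'b \<Rightarrow> ennreal) \<Rightarrow> bool" where
  "pseudometric_on S D \<longleftrightarrow>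
     (\<forall>x\<in>S. \<forall>y\<in>S. D x y < \<top>) \<and>
     (\<forall>x\<in>S. D x x = 0) \<and>
     (\<forall>x\<in>S. \<forall>y\<in>S. D x y = D y x) \<and>
     (\<forall>x\<in>S. \<forall>y\<in>S. \<forall>z\<in>S. D x z \<le> D x y + D y z)"

lemma sets_add_measure [simp]: "sets (add_measure \<mu> \<nu>) = sets \<mu>"
  by (simp add: add_measure_def)

lemma add_measure_borel [simp]:
  "\<mu> \<in> borel_measures \<Longrightarrow> add_measure \<mu> \<nu> \<in> borel_measures"
  by (simp add: borel_measures_def)

lemma density_borel [simp]: "\<mu> \<in> borel_measures \<Longrightarrow> density \<mu> f \<in> borel_measures"
  by (simp add: borel_measures_def)

lemma distr_borel [simp]: "distr \<mu> borel f \<in> borel_measures"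
  by (simp add: borel_measures_def)

lemma borel_measuresD [simp]:
  assumes "\<mu> \<in> borel_measures"
  shows "sets \<mu> = sets borel" "space \<mu> = UNIV"
  using assms sets_eq_imp_space_eq[of \<mu> borel] by (auto simp: borel_measures_def)

lemma emeasure_add_measure:
  assumes "sets \<mu> = sets \<nu>" "E \<in> sets \<mu>"
  shows "emeasure (add_measure \<mu> \<nu>) E = emeasure \<mu> E + emeasure \<nu> E"
proof (rule emeasure_measure_of[OF add_measure_def])
  show "sets \<mu> \<subseteq> Pow (space \<mu>)" by (rule sets.space_closed)
  show "E \<in> sets (add_measure \<mu> \<nu>)" using assms by simp
  show "positive (sets (add_measure \<mu> \<nu>)) (\<lambda>E. emeasure \<mu> E + emeasure \<nu> E)"
    by (simp add: positive_def)
  show "countably_additive (sets (add_measure \<mu> \<nu>)) (\<lambda>E. emeasure \<mu> E + emeasure \<nu> E)"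
    unfolding countably_additive_def using assms(1)
    by (auto simp: suminf_add[symmetric] suminf_emeasure)
qed

lemma add_measure_eq_iff:
  assumes "\<mu> \<in> borel_measures" "\<nu> \<in> borel_measures" "\<sigma> \<in> borel_measures" "\<tau> \<in> borel_measures"
  shows "add_measure \<mu> \<sigma> = add_measure \<nu> \<tau> \<longleftrightarrow>
    (\<forall>E\<in>sets borel. emeasure \<mu> E + emeasure \<sigma> E = emeasure \<nu> E + emeasure \<tau> E)"
proof
  assume eq: "add_measure \<mu> \<sigma> = add_measure \<nu> \<tau>"
  show "\<forall>E\<in>sets borel. emeasure \<mu> E + emeasure \<sigma> E = emeasure \<nu> E + emeasure \<tau> E"
  proof
    fix E :: "'a set" assume "E \<in> sets borel"
    with eq show "emeasure \<mu> E + emeasure \<sigma> E = emeasure \<nu> E + emeasure \<tau> E"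
      using emeasure_add_measure[of \<mu> \<sigma> E] emeasure_add_measure[of \<nu> \<tau> E] assms by simp
  qed
next
  assume "\<forall>E\<in>sets borel. emeasure \<mu> E + emeasure \<sigma> E = emeasure \<nu> E + emeasure \<tau> E"
  then show "add_measure \<mu> \<sigma> = add_measure \<nu> \<tau>"
    by (intro measure_eqI) (simp_all add: assms emeasure_add_measure)
qed

lemma rel_eq_iff:
  fixes A :: "'a::topological_space set"
  assumes A: "closed A"
  shows "(\<mu>, \<nu>) \<in> rel_eq A \<longleftrightarrow> \<mu> \<in> borel_measures \<and> \<nu> \<in> borel_measures \<and>
    (\<forall>E\<in>sets borel. E \<subseteq> - A \<longrightarrow> emeasure \<mu> E = emeasure \<nu> E)" (is "?L \<longleftrightarrow> ?R")
proof
  assume ?L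
  then obtain \<sigma> \<tau> where *: "\<mu> \<in> borel_measures" "\<nu> \<in> borel_measures" "\<sigma> \<in> borel_measures"
    "\<tau> \<in> borel_measures" "emeasure \<sigma> (- A) = 0" "emeasure \<tau> (- A) = 0"
    "add_measure \<mu> \<sigma> = add_measure \<nu> \<tau>"
    unfolding rel_eq_def concentrated_on_def by blast
  have "emeasure \<mu> E = emeasure \<nu> E" if E: "E \<in> sets borel" "E \<subseteq> - A" for E
  proof -
    have "emeasure \<sigma> E = 0" "emeasure \<tau> E = 0"
      using emeasure_mono[of E "- A" \<sigma>] emeasure_mono[of E "- A" \<tau>] A E * by auto
    moreover have "emeasure \<mu> E + emeasure \<sigma> E = emeasure \<nu> E + emeasure \<tau> E"
      using add_measure_eq_iff[OF *(1,2,3,4)] *(7) E(1) by blast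
    ultimately show ?thesis by simp
  qed
  with * show ?R by blast
next
  assume R: ?R
  have AB: "A \<in> sets borel" using A by simp
  let ?\<sigma> = "density \<nu> (indicator A)" and ?\<tau> = "density \<mu> (indicator A)"
  have b: "?\<sigma> \<in> borel_measures" "?\<tau> \<in> borel_measures"
    using R by simp_all
  have em: "emeasure (density \<rho> (indicator A)) E = emeasure \<rho> (A \<inter> E)"
    if "\<rho> \<in> borel_measures" "E \<in> sets borel" for \<rho> :: "'a measure" and E
    using that AB by (simp add: emeasure_restricted)
  have c: "concentrated_on ?\<sigma> A" "concentrated_on ?\<tau> A"
    using R em[of _ "- A"] AB by (auto simp: concentrated_on_def)
  have "add_measure \<mu> ?\<sigma> = add_measure \<nu> ?\<tau>"
  proof (subst add_measure_eq_iff)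
    show "\<forall>E\<in>sets borel. emeasure \<mu> E + emeasure ?\<sigma> E = emeasure \<nu> E + emeasure ?\<tau> E"
    proof
      fix E :: "'a set" assume E: "E \<in> sets borel"
      have s: "emeasure \<rho> E = emeasure \<rho> (A \<inter> E) + emeasure \<rho> (E - A)"
        if "\<rho> \<in> borel_measures" for \<rho> :: "'a measure"
      proof -
        have "(A \<inter> E) \<union> (E - A) = E" "(A \<inter> E) \<inter> (E - A) = {}" by blast+
        then show ?thesis
          using plus_emeasure[of "A \<inter> E" \<rho> "E - A"] that E AB
          by (simp add: sets.Int sets.Diff)
      qed
      have "E - A \<in> sets borel" "E - A \<subseteq> - A" using E AB by auto
      then have d: "emeasure \<mu> (E - A) = emeasure \<nu> (E - A)" using R by blast
      have m: "\<mu> \<in> borel_measures" "\<nu> \<in> borel_measures" using R by auto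
      show "emeasure \<mu> E + emeasure ?\<sigma> E = emeasure \<nu> E + emeasure ?\<tau> E"
        unfolding em[OF m(1) E] em[OF m(2) E] s[OF m(1)] s[OF m(2)] d by (simp only: ac_simps)
    qed
  qed (use R b in auto)
  with R b c show ?L unfolding rel_eq_def by blast
qed

lemma equiv_rel_eq:
  fixes A :: "'a::topological_space set"
  assumes "closed A"
  shows "equiv borel_measures (rel_eq A)"
proof (rule equivI)
  show "rel_eq A \<subseteq> borel_measures \<times> borel_measures" by (auto simp: rel_eq_def)
  show "refl_on borel_measures (rel_eq A)"
    by (auto simp: refl_on_def rel_eq_iff[OF assms])
  show "sym (rel_eq A)" by (auto simp: sym_def rel_eq_iff[OF assms])
  show "trans (rel_eq A)" by (auto simp: trans_def rel_eq_iff[OF assms])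
qed

lemma rel_class_eq:
  assumes "closed A" "(\<mu>, \<nu>) \<in> rel_eq A"
  shows "rel_class A \<mu> = rel_class A \<nu>"
  unfolding rel_class_def using equiv_class_eq[OF equiv_rel_eq[OF assms(1)] assms(2)] .

lemma rel_class_in_rel_measures:
  assumes "\<mu> \<in> borel_measures"
  shows "rel_class A \<mu> \<in> rel_measures A"
  using assms unfolding rel_class_def rel_measures_def by (rule quotientI)

lemma rel_measuresE:
  assumes "M \<in> rel_measures A"
  obtains \<mu> where "\<mu> \<in> borel_measures" "M = rel_class A \<mu>"
  using assms unfolding rel_class_def rel_measures_def by (auto elim: quotientE)

lemma in_rel_class:
  "closed A \<Longrightarrow> \<mu> \<in> borel_measures \<Longrightarrow> \<mu> \<in> rel_class A \<mu>"
  by (simp add: rel_class_def rel_eq_iff)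

lemma rel_add_class:
  assumes A: "closed A" and "\<mu> \<in> borel_measures" "\<nu> \<in> borel_measures"
  shows "rel_add A (rel_class A \<mu>) (rel_class A \<nu>) = rel_class A (add_measure \<mu> \<nu>)"
proof -
  have "rel_class A (add_measure \<mu>' \<nu>') = rel_class A (add_measure \<mu> \<nu>)"
    if "\<mu>' \<in> rel_class A \<mu>" "\<nu>' \<in> rel_class A \<nu>" for \<mu>' \<nu>'
    by (rule rel_class_eq[OF A])
      (use that in \<open>auto simp: rel_class_def rel_eq_iff[OF A] emeasure_add_measure\<close>)
  then show ?thesis
    unfolding rel_add_def using in_rel_class[OF A] assms by blast
qed

lemma rel_push_class:
  assumes A: "closed A" and B: "closed B" and f: "f \<in> borel_measurable borel"
    and AB: "f ` A \<subseteq> B" and \<mu>: "\<mu> \<in> borel_measures"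
  shows "rel_push B f (rel_class A \<mu>) = rel_class B (distr \<mu> borel f)"
proof -
  have "rel_class B (distr \<mu>' borel f) = rel_class B (distr \<mu> borel f)"
    if "\<mu>' \<in> rel_class A \<mu>" for \<mu>'
  proof (rule rel_class_eq[OF B], unfold rel_eq_iff[OF B], safe)
    have r: "\<mu>' \<in> borel_measures" "\<And>E. E \<in> sets borel \<Longrightarrow> E \<subseteq> - A \<Longrightarrow> emeasure \<mu> E = emeasure \<mu>' E"
      using that by (auto simp: rel_class_def rel_eq_iff[OF A])
    show "distr \<mu>' borel f \<in> borel_measures" "distr \<mu> borel f \<in> borel_measures"
      by simp_all
    fix E :: "'b set" assume E: "E \<in> sets borel" "E \<subseteq> - B"
    have m: "f \<in> measurable \<mu>' borel" "f \<in> measurable \<mu> borel"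
      using f r(1) \<mu> by (simp_all cong: measurable_cong_sets)
    have "f -` E \<in> sets borel" using measurable_sets[OF f E(1)] by simp
    moreover have "f -` E \<subseteq> - A" using E(2) AB by auto
    ultimately show "emeasure (distr \<mu>' borel f) E = emeasure (distr \<mu> borel f) E"
      using m r \<mu> E(1) by (simp add: emeasure_distr)
  qed
  then show ?thesis
    unfolding rel_push_def using in_rel_class[OF A \<mu>] by blast
qed

lemma rel_restrict_class:
  assumes A: "closed A" and S: "S \<in> sets borel" and \<mu>: "\<mu> \<in> borel_measures"
  shows "rel_restrict A S (rel_class A \<mu>) = rel_class A (density \<mu> (indicator S))"
proof -
  have "rel_class A (density \<mu>' (indicator S)) = rel_class A (density \<mu> (indicator S))"
    if "\<mu>' \<in> rel_class A \<mu>" for \<mu>'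
  proof (rule rel_class_eq[OF A], unfold rel_eq_iff[OF A], safe)
    have r: "\<mu>' \<in> borel_measures" "\<And>E. E \<in> sets borel \<Longrightarrow> E \<subseteq> - A \<Longrightarrow> emeasure \<mu> E = emeasure \<mu>' E"
      using that by (auto simp: rel_class_def rel_eq_iff[OF A])
    show "density \<mu>' (indicator S) \<in> borel_measures" "density \<mu> (indicator S) \<in> borel_measures"
      using r(1) \<mu> by simp_all
    fix E :: "'a set" assume E: "E \<in> sets borel" "E \<subseteq> - A"
    then have "S \<inter> E \<subseteq> - A" by blast
    then show "emeasure (density \<mu>' (indicator S)) E = emeasure (density \<mu> (indicator S)) E"
      using r \<mu> E S by (simp add: emeasure_restricted)
  qed
  then show ?thesis
    unfolding rel_restrict_def using in_rel_class[OF A \<mu>] by blast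
qed

lemma rel_emeasure_class:
  assumes A: "closed A" and \<mu>: "\<mu> \<in> borel_measures" and E: "E \<in> sets borel" "E \<subseteq> - A"
  shows "rel_emeasure (rel_class A \<mu>) E = emeasure \<mu> E"
  unfolding rel_emeasure_def
proof (rule the_elem_image_unique)
  show "rel_class A \<mu> \<noteq> {}" using in_rel_class[OF A \<mu>] by blast
  show "emeasure \<rho> E = emeasure \<mu> E" if "\<rho> \<in> rel_class A \<mu>" for \<rho>
    using that E by (simp add: rel_class_def rel_eq_iff[OF A])
qed

lemma rel_integral_class:
  assumes A: "closed A" and \<mu>: "\<mu> \<in> borel_measures"
    and f: "f \<in> borel_measurable borel" and 0: "\<And>x. x \<in> A \<Longrightarrow> f x = 0"
  shows "rel_integral (rel_class A \<mu>) f = (\<integral>\<^sup>+x. f x \<partial>\<mu>)"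
proof -
  have *: "(\<integral>\<^sup>+x. f x \<partial>\<rho>) = (\<integral>\<^sup>+x. f x \<partial>density \<rho> (indicator (- A)))"
    if "\<rho> \<in> borel_measures" for \<rho>
  proof -
    have m: "f \<in> borel_measurable \<rho>"
      using f measurable_cong_sets[OF borel_measuresD(1)[OF that] refl, of borel] by blast
    have "(indicator (- A) :: 'a \<Rightarrow> ennreal) \<in> borel_measurable \<rho>"
      using that A by (intro borel_measurable_indicator) simp
    then have "(\<integral>\<^sup>+x. f x \<partial>density \<rho> (indicator (- A))) = (\<integral>\<^sup>+x. indicator (- A) x * f x \<partial>\<rho>)"
      using m by (rule nn_integral_density)
    also have "\<dots> = (\<integral>\<^sup>+x. f x \<partial>\<rho>)"
      by (intro nn_integral_cong) (simp add: 0 indicator_def)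
    finally show ?thesis by (rule sym)
  qed
  have "(\<integral>\<^sup>+x. f x \<partial>\<rho>) = (\<integral>\<^sup>+x. f x \<partial>\<mu>)" if "\<rho> \<in> rel_class A \<mu>" for \<rho>
  proof -
    have r: "\<rho> \<in> borel_measures" "\<And>E. E \<in> sets borel \<Longrightarrow> E \<subseteq> - A \<Longrightarrow> emeasure \<mu> E = emeasure \<rho> E"
      using that by (auto simp: rel_class_def rel_eq_iff[OF A])
    have "density \<rho> (indicator (- A)) = density \<mu> (indicator (- A))"
    proof (rule measure_eqI)
      fix E assume "E \<in> sets (density \<rho> (indicator (- A)))"
      then have "E \<in> sets borel" "- A \<inter> E \<in> sets borel" "- A \<in> sets borel"
        using r(1) A by auto
      then show "emeasure (density \<rho> (indicator (- A))) E = emeasure (density \<mu> (indicator (- A))) E"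
        using r(1) \<mu> r(2)[of "- A \<inter> E"] by (simp add: emeasure_restricted)
    qed (use r(1) \<mu> in simp)
    then show ?thesis unfolding *[OF r(1)] *[OF \<mu>] by (rule arg_cong)
  qed
  moreover have "rel_class A \<mu> \<noteq> {}" using in_rel_class[OF A \<mu>] by blast
  ultimately show ?thesis
    unfolding rel_integral_def by (intro the_elem_image_unique)
qed

end

(*
  A relative measure with finite p-th moment has finite mass away from A, so the couplings of the
  far parts may be taken to be finite measures; their mass on A x A is irrelevant and is used only
  to equalise total masses. Lowering epsilon moves a shell of mass to A along (x, a) and (a, x) and
  leaves the total cost unchanged, so two couplings may be compared at a common epsilon.

  Triangle inequality: the middle space is cut into A and countably many cells of diameter at most
  delta. Two plans with common middle marginal are glued cell by cell, by a density with respect to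
  their product measure; the glued plan moves the middle point by at most delta for d_p. Instead of
  Minkowski's inequality the convexity bound
    (x + y + z)^p <= (s/alpha)^(p-1) x^p + (s/beta)^(p-1) y^p + (s/eta)^(p-1) z^p,
  s = alpha + beta + eta, is integrated, with alpha and beta slightly above the two distances and
  eta small.

  Diracs: the cost d_p^p dominates c1 1_x(u) + c2 1_y(v) almost everywhere for any coupling, where
  c1 + c2 = d_p(x, y)^p, c1 <= d_A(x)^p and c2 <= d_A(y)^p.
*)
theory Submission
  imports Defs
begin

section \<open>Convexity inequalities for real powers\<close>

text \<open>Convexity of the power function at \<open>x + y = (\<alpha> / s) * (s / \<alpha> * x) +
  (\<beta> / s) * (s / \<beta> * y)\<close> with \<open>s = \<alpha> + \<beta>\<close>. Equality
  holds for x : y = \<alpha> : \<beta>, so after integration, with \<alpha> and \<beta> near the two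
  norms, the bound is as good as Minkowski's. Convexity is applied to positive arguments; if
  \<open>x\<close> or \<open>y\<close> vanishes, weights of at least 1 suffice.\<close>

lemma powr_add_le_weighted:
  fixes x y \<alpha> \<beta> p :: real
  assumes p: "1 \<le> p" and nn: "0 \<le> x" "0 \<le> y" and pos: "0 < \<alpha>" "0 < \<beta>"
  shows "(x + y) powr p \<le> ((\<alpha> + \<beta>) / \<alpha>) powr (p - 1) * x powr p + ((\<alpha> + \<beta>) / \<beta>) powr (p - 1) * y powr p"
proof -
  define s where "s = \<alpha> + \<beta>"
  have s: "0 < s" "\<alpha> / s + \<beta> / s = 1" "1 \<le> s / \<alpha>" "1 \<le> s / \<beta>"
    using pos by (simp_all add: s_def add_divide_distrib[symmetric])
  \<comment> \<open>One factor \<open>s / r\<close> is split off the power and cancels the convex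
    coefficient \<open>r / s\<close>.\<close>
  have eq: "r / s * (s / r * z) powr p = (s / r) powr (p - 1) * z powr p" if "0 < r" "0 \<le> z" for r z
  proof -
    have "(s / r) powr p = (s / r) powr (p - 1) * (s / r)"
      using powr_add[of "s / r" "p - 1" 1] that s(1) by simp
    then have "(s / r * z) powr p = (s / r) powr (p - 1) * (s / r) * z powr p"
      using that s(1) powr_mult[of "s / r" z p] by (simp only:)
    then have "r / s * (s / r * z) powr p = (r / s * (s / r)) * ((s / r) powr (p - 1) * z powr p)"
      by (simp only: ac_simps)
    also have "r / s * (s / r) = 1" using that s(1) by simp
    finally show ?thesis by simp
  qed
  show ?thesis
  proof (cases "x = 0 \<or> y = 0")
    case True
    have "1 \<le> (s / \<alpha>) powr (p - 1)" "1 \<le> (s / \<beta>) powr (p - 1)"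
      using s p by (auto intro!: ge_one_powr_ge_zero)
    then show ?thesis
      using True p mult_right_mono[of 1 "(s / \<alpha>) powr (p - 1)" "x powr p"]
        mult_right_mono[of 1 "(s / \<beta>) powr (p - 1)" "y powr p"] unfolding s_def by auto
  next
    case False
    then have xy: "0 < x" "0 < y" using nn by auto
    have w: "1 - \<beta> / s = \<alpha> / s" "\<beta> / s \<le> 1" using s pos by (auto simp: s_def)
    have "(\<alpha> / s * (s / \<alpha> * x) + \<beta> / s * (s / \<beta> * y)) powr p
        \<le> \<alpha> / s * (s / \<alpha> * x) powr p + \<beta> / s * (s / \<beta> * y) powr p"
      using convex_onD[OF powr_convex[OF p], of "\<beta> / s" "s / \<alpha> * x" "s / \<beta> * y"] xy pos s(1) w
      by simp
    then show ?thesis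
      using eq[of \<alpha> x] eq[of \<beta> y] pos xy s(1) unfolding s_def[symmetric] by simp
  qed
qed

text \<open>The two-term bound is applied twice, with \<open>y + z\<close> carrying the weight
  \<open>\<beta> + \<eta>\<close>; the intermediate factor \<open>\<beta> + \<eta>\<close> cancels
  between the two applications.\<close>

lemma powr_add3_le_weighted:
  fixes x y z \<alpha> \<beta> \<eta> p :: real
  assumes p: "1 \<le> p" and nn: "0 \<le> x" "0 \<le> y" "0 \<le> z" and pos: "0 < \<alpha>" "0 < \<beta>" "0 < \<eta>"
  defines "s \<equiv> \<alpha> + \<beta> + \<eta>"
  shows "(x + y + z) powr p \<le> (s / \<alpha>) powr (p - 1) * x powr p
    + (s / \<beta>) powr (p - 1) * y powr p + (s / \<eta>) powr (p - 1) * z powr p"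
proof -
  let ?r = "\<beta> + \<eta>"
  have m: "(s / ?r) powr (p - 1) * (?r / c) powr (p - 1) = (s / c) powr (p - 1)" if "0 < c" for c
    using that pos by (simp add: powr_mult[symmetric] s_def)
  have "(x + (y + z)) powr p \<le> (s / \<alpha>) powr (p - 1) * x powr p + (s / ?r) powr (p - 1) * (y + z) powr p"
    using powr_add_le_weighted[OF p, of x "y + z" \<alpha> ?r] nn pos by (simp add: s_def add.assoc)
  also have "(s / ?r) powr (p - 1) * (y + z) powr p \<le> (s / ?r) powr (p - 1) *
      ((?r / \<beta>) powr (p - 1) * y powr p + (?r / \<eta>) powr (p - 1) * z powr p)"
    using powr_add_le_weighted[OF p, of y z \<beta> \<eta>] nn pos by (intro mult_left_mono) auto
  also have "\<dots> = (s / \<beta>) powr (p - 1) * y powr p + (s / \<eta>) powr (p - 1) * z powr p"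
    using m[of \<beta>] m[of \<eta>] pos by (simp add: distrib_left mult.assoc[symmetric])
  finally show ?thesis by (simp add: add.assoc)
qed

text \<open>This evaluates a weighted term at its ideal size: the terms for all summands of
  \<open>s\<close> then add up to \<open>s powr (p - 1) * s = s powr p\<close>.\<close>

lemma powr_weight_mult_eq:
  fixes s \<alpha> p :: real
  assumes "0 < \<alpha>" "0 < s"
  shows "(s / \<alpha>) powr (p - 1) * \<alpha> powr p = s powr (p - 1) * \<alpha>"
  using assms by (simp add: powr_divide powr_diff)

text \<open>This is Minkowski's inequality in the plane for the vectors (d, 0) and (v, w). It
  follows from the weighted bound with weights \<open>d\<close> and \<open>s\<close>, the p-norm of
  (v, w).\<close>

lemma root_sum_powr_shift_le:
  fixes d v w p :: real
  assumes p: "1 \<le> p" and nn: "0 \<le> d" "0 \<le> v" "0 \<le> w"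
  shows "((d + v) powr p + w powr p) powr (1 / p) \<le> d + (v powr p + w powr p) powr (1 / p)"
proof -
  define s where "s = (v powr p + w powr p) powr (1 / p)"
  have sp: "s powr p = v powr p + w powr p" and s0: "0 \<le> s"
    using p by (auto simp: s_def powr_powr)
  have "(d + v) powr p + w powr p \<le> (d + s) powr p"
  proof (cases "d = 0 \<or> s = 0")
    case True
    then show ?thesis
    proof
      assume "s = 0"
      then have "v powr p + w powr p = 0" using sp p by simp
      then have "v = 0" "w = 0" using nn by (auto simp: add_nonneg_eq_0_iff)
      then show ?thesis using \<open>s = 0\<close> p by simp
    qed (simp add: sp)
  next
    case False
    then have pos: "0 < d" "0 < s" using nn s0 by auto
    let ?b = "((d + s) / s) powr (p - 1)"
    have "1 \<le> ?b" using pos p by (intro ge_one_powr_ge_zero) auto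
    \<comment> \<open>Raising the coefficient of \<open>w powr p\<close> from 1 to that of
      \<open>v powr p\<close> lets the two terms combine to \<open>s powr p\<close>.\<close>
    then have "w powr p \<le> ?b * w powr p" using mult_right_mono[of 1 ?b "w powr p"] by simp
    then have "(d + v) powr p + w powr p
        \<le> ((d + s) / d) powr (p - 1) * d powr p + ?b * (v powr p + w powr p)"
      using powr_add_le_weighted[OF p nn(1,2) pos] by (simp add: distrib_left)
    also have "\<dots> = (d + s) powr (p - 1) * (d + s)"
      unfolding sp[symmetric] using pos by (simp add: powr_weight_mult_eq distrib_left)
    also have "\<dots> = (d + s) powr p" using pos powr_add[of "d + s" "p - 1" 1] by simp
    finally show ?thesis .
  qed
  then have "((d + v) powr p + w powr p) powr (1 / p) \<le> ((d + s) powr p) powr (1 / p)"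
    using p by (intro powr_mono2) auto
  also have "\<dots> = d + s" using p nn s0 by (simp add: powr_powr)
  finally show ?thesis by (simp add: s_def)
qed

section \<open>The pseudometric d_p\<close>

lemma dp_nonneg: "0 \<le> dp p A x y"
  by (simp add: dp_def)

lemma dp_commute: "dp p A x y = dp p A y x"
  by (simp add: dp_def dist_commute add.commute)

lemma dp_powr:
  assumes "1 \<le> p"
  shows "dp p A x y powr p = min (dist x y powr p) (infdist x A powr p + infdist y A powr p)"
proof -
  have m: "mono_on {0..} (\<lambda>t::real. t powr p)"
    using assms by (auto simp: mono_on_def intro!: powr_mono2)
  let ?r = "(infdist x A powr p + infdist y A powr p) powr (1 / p)"
  have "min (dist x y) ?r powr p = min (dist x y powr p) (?r powr p)"
    using mono_onD[OF m, of "dist x y" ?r] mono_onD[OF m, of ?r "dist x y"]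
    by (auto simp: min_def)
  then show ?thesis using assms by (simp add: dp_def powr_powr)
qed

text \<open>Since d(x, a) is at least d_A(x), the minimum always picks the route to the nearest part
  of \<open>A\<close>. Hence the cost of moving mass to \<open>A\<close> does not see the choice of
  \<open>a\<close>.\<close>

lemma dp_eq_infdist:
  assumes "1 \<le> p" "a \<in> A"
  shows "dp p A x a = infdist x A" "dp p A a x = infdist x A"
  using assms infdist_le[OF assms(2), of x]
  by (auto simp: dp_def powr_powr infdist_nonneg dist_commute)

text \<open>Each of the two legs either goes directly or through \<open>A\<close>. Two direct legs
  use the triangle inequality of \<open>dist\<close>; the other combinations bound the route through
  \<open>A\<close> from \<open>x\<close> to \<open>z\<close>, whose length is the p-norm
  \<open>N\<close> of the distances to \<open>A\<close>.\<close>

lemma dp_triangle: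
  assumes p: "1 \<le> p"
  shows "dp p A x z \<le> dp p A x y + dp p A y z"
proof -
  let ?u = "infdist x A" and ?v = "infdist y A" and ?w = "infdist z A"
  define N where "N s t = (s powr p + t powr p) powr (1 / p)" for s t :: real
  have N_mono: "N s t \<le> N s' t" if "0 \<le> s" "s \<le> s'" for s s' t
    using that p unfolding N_def by (intro powr_mono2 add_right_mono) auto
  have N_comm: "N s t = N t s" for s t by (simp add: N_def add.commute)
  have N_ge: "s \<le> N s t" if "0 \<le> s" for s t
    using powr_mono2[of "1 / p" "s powr p" "s powr p + t powr p"] that p by (simp add: N_def powr_powr)
  have N_le: "N s t \<le> s + t" if "0 \<le> s" "0 \<le> t" for s t
    using root_sum_powr_shift_le[OF p that(1) order_refl that(2)] p that by (simp add: N_def powr_powr)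
  have N_shift: "N (d + s) t \<le> d + N s t" if "0 \<le> d" "0 \<le> s" "0 \<le> t" for d s t
    unfolding N_def by (rule root_sum_powr_shift_le[OF p that])
  have "dist x z \<le> dist x y + dist y z" by (rule dist_triangle)
  \<comment> \<open>Both legs through \<open>A\<close>: the p-norm is at most the sum
    \<open>?u + ?w\<close>, and each leg dominates one of these summands.\<close>
  moreover have "N ?u ?w \<le> N ?u ?v + N ?v ?w"
    using N_le[of ?u ?w] N_ge[of ?u ?v] N_ge[of ?w ?v] N_comm[of ?v ?w] by (simp add: infdist_nonneg)
  \<comment> \<open>One direct leg: \<open>infdist\<close> is 1-Lipschitz, so \<open>?u\<close> is
    at most \<open>dist x y + ?v\<close>, and \<open>N_shift\<close> takes the distance out of the
    norm. The next case is its mirror image.\<close>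
  moreover have "N ?u ?w \<le> dist x y + N ?v ?w"
    using N_mono[of ?u "dist x y + ?v" ?w] N_shift[of "dist x y" ?v ?w] infdist_triangle[of x A y]
    by (simp add: infdist_nonneg add.commute)
  moreover have "N ?u ?w \<le> N ?u ?v + dist y z"
    using N_mono[of ?w "dist y z + ?v" ?u] N_shift[of "dist y z" ?v ?u] infdist_triangle[of z A y]
      N_comm[of ?u ?w] N_comm[of ?u ?v]
    by (simp add: infdist_nonneg add.commute dist_commute)
  ultimately show ?thesis unfolding dp_def N_def[symmetric] by linarith
qed

section \<open>Far parts, shells and moments of representatives\<close>

lemma measurable_infdist [measurable]: "(\<lambda>x. infdist x A) \<in> borel_measurable borel"
  by (intro borel_measurable_continuous_onI continuous_intros)

lemma measurable_dp [measurable]: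
  fixes A :: "'a::{second_countable_topology, metric_space} set"
  shows "(\<lambda>z. dp p A (fst z) (snd z)) \<in> borel_measurable borel"
  unfolding dp_def borel_prod[symmetric] by measurable

lemma measurable_borel_measures:
  "\<mu> \<in> borel_measures \<Longrightarrow> f \<in> measurable borel N \<Longrightarrow> f \<in> measurable \<mu> N"
  by (simp cong: measurable_cong_sets)

lemma nn_integral_add_measure:
  assumes \<mu>: "\<mu> \<in> borel_measures" and \<nu>: "\<nu> \<in> borel_measures" and f: "f \<in> borel_measurable borel"
  shows "(\<integral>\<^sup>+x. f x \<partial>add_measure \<mu> \<nu>) = (\<integral>\<^sup>+x. f x \<partial>\<mu>) + (\<integral>\<^sup>+x. f x \<partial>\<nu>)"
  using f
proof (induction rule: borel_measurable_induct)
  case (cong f g)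
  then have "f = g" by (auto simp: fun_eq_iff)
  with cong show ?case by simp
next
  case (set B)
  then show ?case using \<mu> \<nu> by (simp add: emeasure_add_measure)
next
  case (mult u c)
  then show ?case
    using \<mu> \<nu> by (simp add: nn_integral_cmult measurable_borel_measures distrib_left)
next
  case (add u v)
  then show ?case
    using \<mu> \<nu> by (simp add: nn_integral_add measurable_borel_measures ac_simps)
next
  case (seq U)
  have S: "(\<integral>\<^sup>+x. (SUP i. U i) x \<partial>\<rho>) = (SUP i. \<integral>\<^sup>+x. U i x \<partial>\<rho>)" if "\<rho> \<in> borel_measures" for \<rho>
    unfolding SUP_apply
    using seq that by (intro nn_integral_monotone_convergence_SUP) (auto intro: measurable_borel_measures)
  have I: "incseq (\<lambda>i. \<integral>\<^sup>+x. U i x \<partial>\<rho>)" for \<rho>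
    using seq(3) by (auto simp: incseq_def le_fun_def intro!: nn_integral_mono)
  show ?case
    using seq \<mu> \<nu> S by (simp add: ennreal_SUP_add[OF I I])
qed

lemma shell_sets [measurable]:
  "{x. s < infdist x A} \<in> sets borel"
  "{x. s < infdist x A \<and> infdist x A \<le> t} \<in> sets borel"
  by measurable

lemma emeasure_far_shell:
  fixes A :: "'a::metric_space set"
  assumes "\<mu> \<in> borel_measures" "E \<in> sets borel"
  shows "emeasure (density \<mu> (indicator {x. s < infdist x A})) E = emeasure \<mu> ({x. s < infdist x A} \<inter> E)"
    and "emeasure (density \<mu> (indicator {x. s < infdist x A \<and> infdist x A \<le> t})) E
      = emeasure \<mu> ({x. s < infdist x A \<and> infdist x A \<le> t} \<inter> E)"
  using assms shell_sets by (simp_all add: emeasure_restricted)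

definition far_measure :: "'a::metric_space set \<Rightarrow> real \<Rightarrow> 'a measure \<Rightarrow> 'a measure" where
  "far_measure A s \<mu> = density \<mu> (indicator {x. s < infdist x A})"

text \<open>For \<open>s = 0\<close> this represents the near part of a relative measure; a positive
  \<open>s\<close> describes the mass that changes sides when the threshold drops from
  \<open>t\<close> to \<open>s\<close>.\<close>

definition shell_measure :: "'a::metric_space set \<Rightarrow> real \<Rightarrow> real \<Rightarrow> 'a measure \<Rightarrow> 'a measure" where
  "shell_measure A s t \<mu> = density \<mu> (indicator {x. s < infdist x A \<and> infdist x A \<le> t})"

definition moment :: "real \<Rightarrow> 'a::metric_space set \<Rightarrow> 'a measure \<Rightarrow> ennreal" where
  "moment p A \<mu> = (\<integral>\<^sup>+x. ennreal (infdist x A powr p) \<partial>\<mu>)"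

definition transport_cost :: "real \<Rightarrow> 'a::metric_space set \<Rightarrow> ('a \<times> 'a) measure \<Rightarrow> ennreal" where
  "transport_cost p A P = (\<integral>\<^sup>+z. ennreal (dp p A (fst z) (snd z) powr p) \<partial>P)"

text \<open>Couplings of representatives rather than of classes: only the marginals off \<open>A\<close> are prescribed.\<close>

definition coupling_off ::
  "'a::topological_space set \<Rightarrow> ('a \<times> 'a) measure \<Rightarrow> 'a measure \<Rightarrow> 'a measure \<Rightarrow> bool" where
  "coupling_off A P \<mu> \<nu> \<longleftrightarrow> P \<in> borel_measures \<and> (\<forall>E\<in>sets borel. E \<subseteq> - A \<longrightarrow>
     emeasure P (fst -` E) = emeasure \<mu> E \<and> emeasure P (snd -` E) = emeasure \<nu> E)"

lemma far_shell_borel [simp]: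
  "\<mu> \<in> borel_measures \<Longrightarrow> far_measure A s \<mu> \<in> borel_measures"
  "\<mu> \<in> borel_measures \<Longrightarrow> shell_measure A s t \<mu> \<in> borel_measures"
  by (simp_all add: far_measure_def shell_measure_def)

lemma emeasure_far_add_shell:
  assumes "\<mu> \<in> borel_measures" "E \<in> sets borel" "s \<le> t"
  shows "emeasure (far_measure A t \<mu>) E + emeasure (shell_measure A s t \<mu>) E = emeasure (far_measure A s \<mu>) E"
proof -
  let ?F = "{x. t < infdist x A} \<inter> E" and ?S = "{x. s < infdist x A \<and> infdist x A \<le> t} \<inter> E"
  have m: "?F \<in> sets \<mu>" "?S \<in> sets \<mu>"
    using assms shell_sets[of t A] shell_sets(2)[of s A t] by auto
  have "?F \<inter> ?S = {}" "?F \<union> ?S = {x. s < infdist x A} \<inter> E" using assms(3) by auto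
  then show ?thesis
    using plus_emeasure[OF m] by (simp add: far_measure_def shell_measure_def emeasure_far_shell assms)
qed

lemma moment_density:
  assumes \<mu>: "\<mu> \<in> borel_measures" and S: "S \<in> sets borel"
  shows "moment p A (density \<mu> (indicator S)) = (\<integral>\<^sup>+x. ennreal (infdist x A powr p) * indicator S x \<partial>\<mu>)"
  unfolding moment_def using assms
  by (subst nn_integral_density) (auto simp: mult.commute intro: measurable_borel_measures)

lemma moment_shell_add:
  assumes \<mu>: "\<mu> \<in> borel_measures" and "s \<le> t" "r \<le> s"
  shows "moment p A (shell_measure A r s \<mu>) + moment p A (shell_measure A s t \<mu>)
    = moment p A (shell_measure A r t \<mu>)"
proof -
  have m: "(\<lambda>x. ennreal (infdist x A powr p) * indicator {x. u < infdist x A \<and> infdist x A \<le> v} x) \<in> borel_measurable \<mu>"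
    for u v by (rule measurable_borel_measures[OF \<mu>]) measurable
  show ?thesis
    unfolding shell_measure_def moment_density[OF \<mu> shell_sets(2)] nn_integral_add[OF m m, symmetric]
    using assms by (intro nn_integral_cong) (auto simp: indicator_def)
qed

section \<open>Couplings of representatives and change of the threshold\<close>

lemma continuous_measurable_pair:
  "(\<lambda>x. (x, a)) \<in> measurable borel borel" "(\<lambda>x. (a, x)) \<in> measurable borel borel"
  "fst \<in> measurable borel borel" "snd \<in> measurable borel borel"
  by (intro borel_measurable_continuous_onI continuous_intros)+

lemma borel_vimage_fst_snd:
  fixes E :: "'a::topological_space set"
  assumes "E \<in> sets borel"
  shows "(fst :: 'a \<times> 'b::topological_space \<Rightarrow> 'a) -` E \<in> sets borel"
    "(snd :: 'b \<times> 'a \<Rightarrow> 'a) -` E \<in> sets borel"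
  using measurable_sets[OF continuous_measurable_pair(3) assms]
    measurable_sets[OF continuous_measurable_pair(4) assms] by simp_all

text \<open>One construction serves two purposes: \<open>s = 0\<close> produces the elements of
  \<open>eps_couplings\<close> from couplings of far parts, and \<open>s > 0\<close> lowers the
  threshold of a coupling from \<open>t\<close> to \<open>s\<close>.\<close>

definition extend_coupling ::
  "'a::metric_space set \<Rightarrow> 'a \<Rightarrow> real \<Rightarrow> real \<Rightarrow> 'a measure \<Rightarrow> 'a measure \<Rightarrow> ('a \<times> 'a) measure \<Rightarrow> ('a \<times> 'a) measure" where
  "extend_coupling A a s t \<mu> \<nu> P = add_measure
     (add_measure P (distr (shell_measure A s t \<mu>) borel (\<lambda>x. (x, a))))
     (distr (shell_measure A s t \<nu>) borel (\<lambda>x. (a, x)))"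

text \<open>A Borel set off \<open>A\<close> does not contain \<open>a\<close>. Each transported
  shell is therefore visible in exactly one marginal, where it completes the far part at
  \<open>t\<close> to the far part at \<open>s\<close>.\<close>

lemma coupling_off_extend:
  assumes \<mu>: "\<mu> \<in> borel_measures" and \<nu>: "\<nu> \<in> borel_measures" and a: "a \<in> A" and "s \<le> t"
    and P: "coupling_off A P (far_measure A t \<mu>) (far_measure A t \<nu>)"
  shows "coupling_off A (extend_coupling A a s t \<mu> \<nu> P) (far_measure A s \<mu>) (far_measure A s \<nu>)"
proof -
  let ?m = "distr (shell_measure A s t \<mu>) borel (\<lambda>x. (x, a))"
  let ?n = "distr (shell_measure A s t \<nu>) borel (\<lambda>x. (a, x))"
  have PB: "P \<in> borel_measures" using P by (simp add: coupling_off_def)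
  have em: "emeasure (extend_coupling A a s t \<mu> \<nu> P) E = emeasure P E
      + emeasure (shell_measure A s t \<mu>) ((\<lambda>x. (x, a)) -` E) + emeasure (shell_measure A s t \<nu>) ((\<lambda>x. (a, x)) -` E)"
    if "E \<in> sets borel" for E
    unfolding extend_coupling_def using that PB \<mu> \<nu>
    by (simp add: emeasure_add_measure emeasure_distr measurable_borel_measures continuous_measurable_pair)
  show ?thesis
    unfolding coupling_off_def
  proof (intro conjI ballI impI)
    show "extend_coupling A a s t \<mu> \<nu> P \<in> borel_measures"
      using PB by (simp add: extend_coupling_def)
    fix E assume E: "E \<in> sets borel" "E \<subseteq> - A"
    then have "a \<notin> E" using a by auto
    then have *: "(\<lambda>x. (x, a)) -` (fst -` E) = E" "(\<lambda>x. (a, x)) -` (fst -` E) = {}"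
      "(\<lambda>x. (x, a)) -` (snd -` E) = {}" "(\<lambda>x. (a, x)) -` (snd -` E) = E" by auto
    have "emeasure P (fst -` E) = emeasure (far_measure A t \<mu>) E"
      "emeasure P (snd -` E) = emeasure (far_measure A t \<nu>) E"
      using P E by (auto simp: coupling_off_def)
    then show "emeasure (extend_coupling A a s t \<mu> \<nu> P) (fst -` E) = emeasure (far_measure A s \<mu>) E"
      "emeasure (extend_coupling A a s t \<mu> \<nu> P) (snd -` E) = emeasure (far_measure A s \<nu>) E"
      using em[OF borel_vimage_fst_snd(1)[OF E(1)]] em[OF borel_vimage_fst_snd(2)[OF E(1)]]
        emeasure_far_add_shell[OF \<mu> E(1) \<open>s \<le> t\<close>, of A] emeasure_far_add_shell[OF \<nu> E(1) \<open>s \<le> t\<close>, of A]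
      unfolding * by simp_all
  qed
qed

text \<open>By \<open>dp_eq_infdist\<close> a pair (x, a) or (a, x) costs exactly d_A(x)^p, so the
  transported shells contribute their moments.\<close>

lemma transport_cost_extend:
  fixes A :: "'a::polish_space set"
  assumes p: "1 \<le> p" and \<mu>: "\<mu> \<in> borel_measures" and \<nu>: "\<nu> \<in> borel_measures" and a: "a \<in> A"
    and P: "P \<in> borel_measures"
  shows "transport_cost p A (extend_coupling A a s t \<mu> \<nu> P)
    = transport_cost p A P + moment p A (shell_measure A s t \<mu>) + moment p A (shell_measure A s t \<nu>)"
  unfolding extend_coupling_def transport_cost_def moment_def using assms
  by (simp add: nn_integral_add_measure nn_integral_distr measurable_borel_measures
      continuous_measurable_pair dp_eq_infdist)

section \<open>From relative measures to representatives\<close>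

lemma rel_class_eq_iff:
  assumes "closed A" "\<mu> \<in> borel_measures" "\<nu> \<in> borel_measures"
  shows "rel_class A \<mu> = rel_class A \<nu> \<longleftrightarrow> (\<forall>E\<in>sets borel. E \<subseteq> - A \<longrightarrow> emeasure \<mu> E = emeasure \<nu> E)"
  using eq_equiv_class_iff[OF equiv_rel_eq[OF assms(1)] assms(2,3)] assms
  by (simp add: rel_class_def rel_eq_iff)

lemma coupling_off_cong:
  assumes "\<And>E. E \<in> sets borel \<Longrightarrow> E \<subseteq> - A \<Longrightarrow> emeasure \<mu> E = emeasure \<mu>' E"
    and "\<And>E. E \<in> sets borel \<Longrightarrow> E \<subseteq> - A \<Longrightarrow> emeasure \<nu> E = emeasure \<nu>' E"
  shows "coupling_off A P \<mu> \<nu> \<longleftrightarrow> coupling_off A P \<mu>' \<nu>'"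
  using assms by (auto simp: coupling_off_def)

text \<open>As \<open>A\<close> is closed and nonempty, d_A is positive off \<open>A\<close>, so the
  threshold 0 discards mass on \<open>A\<close> only.\<close>

lemma emeasure_far_zero:
  assumes "closed A" "A \<noteq> {}" "\<mu> \<in> borel_measures" "E \<in> sets borel" "E \<subseteq> - A"
  shows "emeasure (far_measure A 0 \<mu>) E = emeasure \<mu> E"
proof -
  have "{x. 0 < infdist x A} \<inter> E = E"
    using assms infdist_pos_not_in_closed[OF assms(1,2)] by auto
  then show ?thesis
    using emeasure_far_shell(1)[OF assms(3,4), of 0 A] by (simp add: far_measure_def)
qed

lemma rel_class_in_couplings_iff:
  fixes A :: "'a::metric_space set"
  assumes A: "closed A" and P: "P \<in> borel_measures" and \<mu>: "\<mu> \<in> borel_measures" and \<nu>: "\<nu> \<in> borel_measures"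
  shows "rel_class (A \<times> A) P \<in> couplings A (rel_class A \<mu>) (rel_class A \<nu>) \<longleftrightarrow> coupling_off A P \<mu> \<nu>"
proof -
  have AA: "closed (A \<times> A)" using A by (rule closed_Times[OF _ A])
  have push: "rel_push A fst (rel_class (A \<times> A) P) = rel_class A (distr P borel fst)"
    "rel_push A snd (rel_class (A \<times> A) P) = rel_class A (distr P borel snd)"
    by (rule rel_push_class[OF AA A _ _ P]; auto intro: continuous_measurable_pair)+
  have em: "emeasure (distr P borel fst) E = emeasure P (fst -` E)"
    "emeasure (distr P borel snd) E = emeasure P (snd -` E)" if "E \<in> sets borel" for E
    using that P by (auto simp: emeasure_distr measurable_borel_measures continuous_measurable_pair)
  show ?thesis
    using P rel_class_in_rel_measures[OF P, of "A \<times> A"]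
    by (auto simp: couplings_def push rel_class_eq_iff[OF A _ \<mu>] rel_class_eq_iff[OF A _ \<nu>] em coupling_off_def)
qed

text \<open>A coupling of the far parts is the class of some Borel measure, and all operations in
  the definition act on representatives. The infimum defining \<open>Wp\<close> can thus be taken
  over plain measures.\<close>

lemma eps_couplings_class:
  fixes A :: "'a::metric_space set"
  assumes A: "closed A" and a: "a \<in> A" and \<mu>: "\<mu> \<in> borel_measures" and \<nu>: "\<nu> \<in> borel_measures"
    and \<epsilon>: "0 < \<epsilon>"
  shows "eps_couplings A a \<epsilon> (rel_class A \<mu>) (rel_class A \<nu>)
    = (\<lambda>P. rel_class (A \<times> A) (extend_coupling A a 0 \<epsilon> \<mu> \<nu> P))
      ` {P. coupling_off A P (far_measure A \<epsilon> \<mu>) (far_measure A \<epsilon> \<nu>)}"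
proof -
  have AA: "closed (A \<times> A)" using A by (rule closed_Times[OF _ A])
  have ne: "A \<noteq> {}" using a by blast
  let ?C = "\<lambda>P. rel_class (A \<times> A) (extend_coupling A a 0 \<epsilon> \<mu> \<nu> P)"
  have far: "far_part A \<epsilon> (rel_class A \<rho>) = rel_class A (far_measure A \<epsilon> \<rho>)" if "\<rho> \<in> borel_measures" for \<rho>
    unfolding far_part_def far_measure_def using that A by (intro rel_restrict_class) auto
  have near: "near_part A \<epsilon> (rel_class A \<rho>) = rel_class A (shell_measure A 0 \<epsilon> \<rho>)" if "\<rho> \<in> borel_measures" for \<rho>
    unfolding near_part_def shell_measure_def using that A by (intro rel_restrict_class) auto
  have push: "rel_push (A \<times> A) (\<lambda>x. (x, a)) (rel_class A \<rho>) = rel_class (A \<times> A) (distr \<rho> borel (\<lambda>x. (x, a)))"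
    "rel_push (A \<times> A) (\<lambda>x. (a, x)) (rel_class A \<rho>) = rel_class (A \<times> A) (distr \<rho> borel (\<lambda>x. (a, x)))"
    if "\<rho> \<in> borel_measures" for \<rho>
    by (rule rel_push_class[OF A AA _ _ that]; (rule continuous_measurable_pair | use a in blast))+
  have sum: "rel_add (A \<times> A) (rel_add (A \<times> A) (rel_class (A \<times> A) P)
        (rel_push (A \<times> A) (\<lambda>x. (x, a)) (near_part A \<epsilon> (rel_class A \<mu>))))
        (rel_push (A \<times> A) (\<lambda>x. (a, x)) (near_part A \<epsilon> (rel_class A \<nu>))) = ?C P"
    if "P \<in> borel_measures" for P
    using that \<mu> \<nu> by (simp add: near push rel_add_class[OF AA] extend_coupling_def)
  \<comment> \<open>Extending down to the threshold 0 restores all mass off \<open>A\<close>, so the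
    marginals are the classes of \<mu> and \<nu> themselves.\<close>
  have in_c: "?C P \<in> couplings A (rel_class A \<mu>) (rel_class A \<nu>)"
    if P: "coupling_off A P (far_measure A \<epsilon> \<mu>) (far_measure A \<epsilon> \<nu>)" for P
  proof -
    have "coupling_off A (extend_coupling A a 0 \<epsilon> \<mu> \<nu> P) (far_measure A 0 \<mu>) (far_measure A 0 \<nu>)"
      using coupling_off_extend[OF \<mu> \<nu> a _ P, of 0] \<epsilon> by simp
    then have "coupling_off A (extend_coupling A a 0 \<epsilon> \<mu> \<nu> P) \<mu> \<nu>"
      using coupling_off_cong[of A "far_measure A 0 \<mu>" \<mu> "far_measure A 0 \<nu>" \<nu>]
        emeasure_far_zero[OF A ne \<mu>] emeasure_far_zero[OF A ne \<nu>] by blast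
    then show ?thesis
      using rel_class_in_couplings_iff[OF A _ \<mu> \<nu>] by (auto simp: coupling_off_def)
  qed
  show ?thesis
  proof (intro set_eqI iffI)
    fix R assume "R \<in> eps_couplings A a \<epsilon> (rel_class A \<mu>) (rel_class A \<nu>)"
    then obtain Q where Q: "Q \<in> couplings A (far_part A \<epsilon> (rel_class A \<mu>)) (far_part A \<epsilon> (rel_class A \<nu>))"
      and R: "R = rel_add (A \<times> A) (rel_add (A \<times> A) Q
        (rel_push (A \<times> A) (\<lambda>x. (x, a)) (near_part A \<epsilon> (rel_class A \<mu>))))
        (rel_push (A \<times> A) (\<lambda>x. (a, x)) (near_part A \<epsilon> (rel_class A \<nu>)))"
      unfolding eps_couplings_def by blast
    obtain P where P: "P \<in> borel_measures" "Q = rel_class (A \<times> A) P"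
      using Q by (auto simp: couplings_def elim: rel_measuresE)
    have "coupling_off A P (far_measure A \<epsilon> \<mu>) (far_measure A \<epsilon> \<nu>)"
      using Q rel_class_in_couplings_iff[OF A P(1)] \<mu> \<nu> by (simp add: P(2) far)
    then show "R \<in> ?C ` {P. coupling_off A P (far_measure A \<epsilon> \<mu>) (far_measure A \<epsilon> \<nu>)}"
      using R P(1) by (auto simp: P(2) sum)
  next
    fix R assume "R \<in> ?C ` {P. coupling_off A P (far_measure A \<epsilon> \<mu>) (far_measure A \<epsilon> \<nu>)}"
    then obtain P where P: "coupling_off A P (far_measure A \<epsilon> \<mu>) (far_measure A \<epsilon> \<nu>)" and R: "R = ?C P"
      by blast
    have PB: "P \<in> borel_measures" using P by (simp add: coupling_off_def)
    have "rel_class (A \<times> A) P \<in> couplings A (far_part A \<epsilon> (rel_class A \<mu>)) (far_part A \<epsilon> (rel_class A \<nu>))"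
      using P rel_class_in_couplings_iff[OF A PB] \<mu> \<nu> by (simp add: far)
    then show "R \<in> eps_couplings A a \<epsilon> (rel_class A \<mu>) (rel_class A \<nu>)"
      unfolding eps_couplings_def using in_c[OF P] R sum[OF PB] by auto
  qed
qed

text \<open>By \<open>transport_cost_extend\<close> this is the integral of the cost over the
  extension of \<open>P\<close> to the threshold 0.\<close>

definition total_cost ::
  "real \<Rightarrow> 'a::metric_space set \<Rightarrow> real \<Rightarrow> 'a measure \<Rightarrow> 'a measure \<Rightarrow> ('a \<times> 'a) measure \<Rightarrow> ennreal" where
  "total_cost p A \<epsilon> \<mu> \<nu> P = transport_cost p A P
     + moment p A (shell_measure A 0 \<epsilon> \<mu>) + moment p A (shell_measure A 0 \<epsilon> \<nu>)"

text \<open>This is the p-th power of the Wasserstein distance, expressed through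
  representatives.\<close>

definition wcost :: "real \<Rightarrow> 'a::metric_space set \<Rightarrow> 'a measure \<Rightarrow> 'a measure \<Rightarrow> ennreal" where
  "wcost p A \<mu> \<nu> = (INF \<epsilon>\<in>{0<..}.
     INF P\<in>{P. coupling_off A P (far_measure A \<epsilon> \<mu>) (far_measure A \<epsilon> \<nu>)}. total_cost p A \<epsilon> \<mu> \<nu> P)"

lemma Wp_class:
  fixes A :: "'a::polish_space set"
  assumes p: "1 \<le> p" and A: "closed A" and a: "a \<in> A" and \<mu>: "\<mu> \<in> borel_measures" and \<nu>: "\<nu> \<in> borel_measures"
  shows "Wp p A a (rel_class A \<mu>) (rel_class A \<nu>) = ennreal_root p (wcost p A \<mu> \<nu>)"
proof -
  have AA: "closed (A \<times> A)" using A by (rule closed_Times[OF _ A])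
  have "rel_integral (rel_class (A \<times> A) (extend_coupling A a 0 \<epsilon> \<mu> \<nu> P)) (\<lambda>(x, y). ennreal (dp p A x y powr p))
      = total_cost p A \<epsilon> \<mu> \<nu> P"
    if "coupling_off A P (far_measure A \<epsilon> \<mu>) (far_measure A \<epsilon> \<nu>)" for P \<epsilon>
  proof -
    have PB: "P \<in> borel_measures" using that by (simp add: coupling_off_def)
    then have E: "extend_coupling A a 0 \<epsilon> \<mu> \<nu> P \<in> borel_measures" by (simp add: extend_coupling_def)
    have z: "dp p A x y = 0" if "x \<in> A" "y \<in> A" for x y
      using that p by (simp add: dp_eq_infdist)
    show ?thesis
      unfolding total_cost_def transport_cost_extend[OF p \<mu> \<nu> a PB, symmetric]
      by (subst rel_integral_class[OF AA E])
        (auto simp: transport_cost_def case_prod_unfold z)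
  qed
  note cost = this
  have "(INF P\<in>eps_couplings A a \<epsilon> (rel_class A \<mu>) (rel_class A \<nu>).
        rel_integral P (\<lambda>(x, y). ennreal (dp p A x y powr p)))
      = (INF P\<in>{P. coupling_off A P (far_measure A \<epsilon> \<mu>) (far_measure A \<epsilon> \<nu>)}. total_cost p A \<epsilon> \<mu> \<nu> P)"
    if "0 < \<epsilon>" for \<epsilon>
    unfolding eps_couplings_class[OF A a \<mu> \<nu> that] image_image
    by (rule INF_cong[OF refl]) (simp add: cost)
  then show ?thesis unfolding Wp_def wcost_def by simp
qed

section \<open>Gluing of transport plans\<close>

text \<open>Discrete gluing, which replaces disintegration: the two plans are multiplied inside each cell of
  the common marginal, normalised by the mass of the cell.\<close>

lemma glue_along_cells:
  fixes u :: "'b \<Rightarrow> nat" and v :: "'c \<Rightarrow> nat"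
  assumes P: "finite_measure P" and Q: "finite_measure Q"
    and u: "u \<in> measurable P (count_space UNIV)" and v: "v \<in> measurable Q (count_space UNIV)"
    and eq: "\<And>k. emeasure P (u -` {k} \<inter> space P) = emeasure Q (v -` {k} \<inter> space Q)"
  obtains G where "sets G = sets (P \<Otimes>\<^sub>M Q)"
    and "\<And>f. f \<in> borel_measurable P \<Longrightarrow> (\<integral>\<^sup>+z. f (fst z) \<partial>G) = (\<integral>\<^sup>+x. f x \<partial>P)"
    and "\<And>f. f \<in> borel_measurable Q \<Longrightarrow> (\<integral>\<^sup>+z. f (snd z) \<partial>G) = (\<integral>\<^sup>+x. f x \<partial>Q)"
    and "AE z in G. u (fst z) = v (snd z)"
proof -
  interpret P: finite_measure P by (rule P)
  interpret Q: finite_measure Q by (rule Q)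
  interpret PQ: pair_sigma_finite P Q ..
  note u[measurable] v[measurable]
  define c where "c k = emeasure P (u -` {k} \<inter> space P)" for k
  have cQ: "c k = emeasure Q (v -` {k} \<inter> space Q)" for k using eq by (simp add: c_def)
  have fin: "c k \<noteq> \<top>" for k by (simp add: c_def)
  \<comment> \<open>On cells of mass zero the inverse is \<top>, but these cells are null for both
    plans (\<open>nzP\<close>, \<open>nzQ\<close>). On every other cell the sections of
    \<open>h\<close> integrate to \<open>inverse (c k) * c k = 1\<close>, which gives
    \<open>G\<close> the right marginals.\<close>
  define h :: "'b \<times> 'c \<Rightarrow> ennreal" where "h z = (if u (fst z) = v (snd z) then inverse (c (u (fst z))) else 0)" for z
  have h [measurable]: "h \<in> borel_measurable (P \<Otimes>\<^sub>M Q)"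
  proof -
    have "(\<lambda>k. inverse (c k)) \<in> borel_measurable (count_space UNIV)" by simp
    then have "(\<lambda>z. inverse (c (u (fst z)))) \<in> borel_measurable (P \<Otimes>\<^sub>M Q)"
      by (rule measurable_compose[rotated]) measurable
    \<comment> \<open>Equality of the labels is written as a countable disjunction, which reduces
      measurability to single cells.\<close>
    moreover have "Measurable.pred (P \<Otimes>\<^sub>M Q) (\<lambda>z. \<exists>k. u (fst z) = k \<and> v (snd z) = k)"
      by measurable
    then have "Measurable.pred (P \<Otimes>\<^sub>M Q) (\<lambda>z. u (fst z) = v (snd z))"
      by (simp add: eq_commute)
    ultimately show ?thesis unfolding h_def by measurable
  qed
  define G where "G = density (P \<Otimes>\<^sub>M Q) h"
  have nzP: "AE x in P. c (u x) \<noteq> 0"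
  proof -
    have "AE x in P. \<forall>k. c k = 0 \<longrightarrow> u x \<noteq> k"
    proof (subst AE_all_countable, rule allI)
      fix k show "AE x in P. c k = 0 \<longrightarrow> u x \<noteq> k"
      proof (cases "c k = 0")
        case True
        then have "u -` {k} \<inter> space P \<in> null_sets P" by (auto simp: c_def null_sets_def)
        then show ?thesis by (rule AE_I') auto
      qed simp
    qed
    then show ?thesis by eventually_elim auto
  qed
  have nzQ: "AE x in Q. c (v x) \<noteq> 0"
  proof -
    have "AE x in Q. \<forall>k. c k = 0 \<longrightarrow> v x \<noteq> k"
    proof (subst AE_all_countable, rule allI)
      fix k show "AE x in Q. c k = 0 \<longrightarrow> v x \<noteq> k"
      proof (cases "c k = 0")
        case True
        then have "v -` {k} \<inter> space Q \<in> null_sets Q" by (auto simp: cQ null_sets_def)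
        then show ?thesis by (rule AE_I') auto
      qed simp
    qed
    then show ?thesis by eventually_elim auto
  qed
  have one: "inverse (c k) * c k = 1" if "c k \<noteq> 0" for k
    using ennreal_divide_self[OF that] fin[of k] by (simp add: divide_ennreal_def mult.commute less_top)
  have intQ: "(\<integral>\<^sup>+w. h (z, w) \<partial>Q) = inverse (c (u z)) * c (u z)" for z
  proof -
    have "(\<integral>\<^sup>+w. h (z, w) \<partial>Q) = (\<integral>\<^sup>+w. inverse (c (u z)) * indicator (v -` {u z} \<inter> space Q) w \<partial>Q)"
      by (intro nn_integral_cong) (auto simp: h_def indicator_def)
    then show ?thesis by (simp add: nn_integral_cmult_indicator cQ)
  qed
  have intP: "(\<integral>\<^sup>+z. h (z, w) \<partial>P) = inverse (c (v w)) * c (v w)" for w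
  proof -
    have "(\<integral>\<^sup>+z. h (z, w) \<partial>P) = (\<integral>\<^sup>+z. inverse (c (v w)) * indicator (u -` {v w} \<inter> space P) z \<partial>P)"
      by (intro nn_integral_cong) (auto simp: h_def indicator_def)
    then show ?thesis by (simp add: nn_integral_cmult_indicator c_def)
  qed
  show thesis
  proof
    show "sets G = sets (P \<Otimes>\<^sub>M Q)" by (simp add: G_def)
    show "AE z in G. u (fst z) = v (snd z)"
      unfolding G_def by (subst AE_density[OF h]) (auto simp: h_def)
    show "(\<integral>\<^sup>+z. f (fst z) \<partial>G) = (\<integral>\<^sup>+x. f x \<partial>P)" if f[measurable]: "f \<in> borel_measurable P" for f
    proof -
      have "(\<integral>\<^sup>+z. f (fst z) \<partial>G) = (\<integral>\<^sup>+z. h z * f (fst z) \<partial>(P \<Otimes>\<^sub>M Q))"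
        unfolding G_def by (rule nn_integral_density) measurable
      also have "\<dots> = (\<integral>\<^sup>+x. \<integral>\<^sup>+w. h (x, w) * f x \<partial>Q \<partial>P)"
        by (subst Q.nn_integral_fst[symmetric]) simp_all
      also have "\<dots> = (\<integral>\<^sup>+x. f x \<partial>P)"
        using nzP AE_space[of P]
        by (intro nn_integral_cong_AE, elim AE_mp, intro AE_I2 impI)
          (simp add: nn_integral_multc measurable_Pair2[OF h] intQ one)
      finally show ?thesis .
    qed
    show "(\<integral>\<^sup>+z. f (snd z) \<partial>G) = (\<integral>\<^sup>+x. f x \<partial>Q)" if f[measurable]: "f \<in> borel_measurable Q" for f
    proof -
      have "(\<integral>\<^sup>+z. f (snd z) \<partial>G) = (\<integral>\<^sup>+z. h z * f (snd z) \<partial>(P \<Otimes>\<^sub>M Q))"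
        unfolding G_def by (rule nn_integral_density) measurable
      also have "\<dots> = (\<integral>\<^sup>+w. \<integral>\<^sup>+x. h (x, w) * f w \<partial>P \<partial>Q)"
        by (subst PQ.nn_integral_snd[symmetric]) simp_all
      also have "\<dots> = (\<integral>\<^sup>+x. f x \<partial>Q)"
        using nzQ AE_space[of Q]
        by (intro nn_integral_cong_AE, elim AE_mp, intro AE_I2 impI)
          (simp add: nn_integral_multc measurable_Pair1[OF h] intP one)
      finally show ?thesis .
    qed
  qed
qed

text \<open>The set \<open>A\<close> forms one cell because d_p vanishes on A x A. Any other point
  is labelled by the first member of a dense sequence within distance \<delta>/2; the shift by
  \<open>Suc\<close> reserves the label 0 for \<open>A\<close>.\<close>

lemma small_cells:
  fixes A :: "'a::{second_countable_topology, metric_space} set"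
  assumes p: "1 \<le> p" and A: "closed A" and \<delta>: "0 < \<delta>"
  obtains I :: "'a \<Rightarrow> nat" where "I \<in> measurable borel (count_space UNIV)"
    and "\<And>x. I x = 0 \<longleftrightarrow> x \<in> A" and "\<And>x y. I x = I y \<Longrightarrow> dp p A x y \<le> \<delta>"
proof -
  obtain D :: "'a set" where D: "countable D" "\<And>X. open X \<Longrightarrow> X \<noteq> {} \<Longrightarrow> \<exists>d\<in>D. d \<in> X"
    using countable_dense_setE by blast
  have "D \<noteq> {}" using D(2)[of UNIV] by auto
  define e where "e = from_nat_into D"
  have e: "\<exists>n. dist x (e n) < \<delta> / 2" for x
  proof -
    obtain d where "d \<in> D" "d \<in> ball x (\<delta> / 2)"
      using D(2)[of "ball x (\<delta> / 2)"] \<delta> by auto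
    then show ?thesis
      using from_nat_into_surj[OF D(1)] by (metis e_def mem_ball)
  qed
  define I where "I x = (if x \<in> A then 0 else Suc (LEAST n. dist x (e n) < \<delta> / 2))" for x
  show thesis
  proof
    have [measurable]: "A \<in> sets borel" using A by simp
    show "I \<in> measurable borel (count_space UNIV)" unfolding I_def by measurable
    show "I x = 0 \<longleftrightarrow> x \<in> A" for x by (simp add: I_def)
    fix x y assume xy: "I x = I y"
    show "dp p A x y \<le> \<delta>"
    proof (cases "x \<in> A")
      case True
      then have "y \<in> A" using xy by (auto simp: I_def split: if_splits)
      with True show ?thesis using p \<delta> by (simp add: dp_eq_infdist)
    next
      case False
      then have "y \<notin> A" using xy by (auto simp: I_def)
      with False xy have "dist x (e n) < \<delta> / 2" "dist y (e n) < \<delta> / 2"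
        if "n = (LEAST n. dist x (e n) < \<delta> / 2)" for n
        using LeastI_ex[OF e[of x]] LeastI_ex[OF e[of y]] that by (simp_all add: I_def)
      then have "dist x y < \<delta>" using dist_triangle_half_l by blast
      then show ?thesis by (simp add: dp_def)
    qed
  qed
qed

text \<open>The mass on \<open>A \<times> A\<close> is free. Two plans of equal total mass put the same mass on the cell \<open>A\<close> of
  their common marginal, as the gluing requires.\<close>

lemma coupling_off_with_mass:
  fixes A :: "'a::polish_space set"
  assumes p: "1 \<le> p" and A: "closed A" and a: "a \<in> A"
    and P: "coupling_off A P \<mu> \<nu>"
    and C: "emeasure \<mu> (- A) + emeasure \<nu> (- A) \<le> C"
  obtains P' where "coupling_off A P' \<mu> \<nu>" "emeasure P' UNIV = C" "transport_cost p A P' = transport_cost p A P"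
proof -
  define U where "U = - (A \<times> A)"
  have PB: "P \<in> borel_measures" using P by (simp add: coupling_off_def)
  have "closed (A \<times> A)" using A by (rule closed_Times[OF _ A])
  then have U: "U \<in> sets borel" by (simp add: U_def)
  have cA: "- A \<in> sets borel" using A by simp
  \<comment> \<open>Off A x A at least one coordinate lies off \<open>A\<close>, so the two
    marginals control the mass there.\<close>
  have "emeasure P U \<le> emeasure P (fst -` (- A) \<union> snd -` (- A))"
    using PB borel_vimage_fst_snd[OF cA] by (intro emeasure_mono) (auto simp: U_def)
  also have "\<dots> \<le> emeasure P (fst -` (- A)) + emeasure P (snd -` (- A))"
    using PB borel_vimage_fst_snd[OF cA] by (intro emeasure_subadditive) auto
  also have "\<dots> \<le> C" using P C cA by (simp add: coupling_off_def)
  finally have le: "emeasure P U \<le> C" .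
  \<comment> \<open>The missing mass is placed at (a, a), where it has cost zero and is invisible to
    both marginals off \<open>A\<close>.\<close>
  define R where "R = scale_measure (C - emeasure P U) (return borel (a, a))"
  have RB: "R \<in> borel_measures" unfolding R_def borel_measures_def by simp
  have Rem: "emeasure R E = (C - emeasure P U) * indicator E (a, a)" if "E \<in> sets borel" for E
    using that by (simp add: R_def)
  define P' where "P' = add_measure (density P (indicator U)) R"
  have em: "emeasure P' E = emeasure P (U \<inter> E) + (C - emeasure P U) * indicator E (a, a)" if "E \<in> sets borel" for E
    using that PB RB U by (simp add: P'_def emeasure_add_measure emeasure_restricted Rem)
  show thesis
  proof
    show "coupling_off A P' \<mu> \<nu>"
      unfolding coupling_off_def
    proof (intro conjI ballI impI)
      show "P' \<in> borel_measures" using PB by (simp add: P'_def)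
      fix E assume E: "E \<in> sets borel" "E \<subseteq> - A"
      then have "U \<inter> fst -` E = fst -` E" "U \<inter> snd -` E = snd -` E" "a \<notin> E"
        using a by (auto simp: U_def)
      then show "emeasure P' (fst -` E) = emeasure \<mu> E" "emeasure P' (snd -` E) = emeasure \<nu> E"
        using P E em[OF borel_vimage_fst_snd(1)[OF E(1)]] em[OF borel_vimage_fst_snd(2)[OF E(1)]]
        by (simp_all add: coupling_off_def)
    qed
    show "emeasure P' UNIV = C"
      using em[of UNIV] le by (simp add: add_diff_inverse_ennreal)
    have z: "dp p A x y = 0" if "x \<in> A" "y \<in> A" for x y
      using that p by (simp add: dp_eq_infdist)
    have "(\<integral>\<^sup>+z. ennreal (dp p A (fst z) (snd z) powr p) \<partial>density P (indicator U))
        = (\<integral>\<^sup>+z. indicator U z * ennreal (dp p A (fst z) (snd z) powr p) \<partial>P)"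
      using U by (intro nn_integral_density; intro measurable_borel_measures[OF PB]) simp_all
    also have "\<dots> = transport_cost p A P"
      unfolding transport_cost_def
      by (intro nn_integral_cong) (auto simp: indicator_def U_def z)
    finally show "transport_cost p A P' = transport_cost p A P"
      using PB RB a unfolding transport_cost_def P'_def
      by (simp add: nn_integral_add_measure R_def nn_integral_scale_measure nn_integral_return z)
  qed
qed

text \<open>Both plans are normalised to the same total mass and glued along small cells of the
  middle space. The glued plan has a gap of at most \<delta> in the middle, so the three-term
  weighted inequality applies, its last term paying for the gap.\<close>

lemma coupling_off_triangle:
  fixes A :: "'a::polish_space set"
  assumes p: "1 \<le> p" and A: "closed A" and a: "a \<in> A"
    and P: "coupling_off A P \<mu> \<nu>" and Q: "coupling_off A Q \<nu> \<rho>"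
    and fin: "emeasure \<mu> (- A) < \<top>" "emeasure \<nu> (- A) < \<top>" "emeasure \<rho> (- A) < \<top>"
    and pos: "0 < \<alpha>" "0 < \<beta>" "0 < \<eta>"
  defines "s \<equiv> \<alpha> + \<beta> + \<eta>"
  obtains R where "coupling_off A R \<mu> \<rho>" and "transport_cost p A R \<le>
    ennreal ((s / \<alpha>) powr (p - 1)) * transport_cost p A P
    + ennreal ((s / \<beta>) powr (p - 1)) * transport_cost p A Q + ennreal (s powr (p - 1) * \<eta>)"
proof -
  define w where "w t = (s / t) powr (p - 1)" for t
  have w0: "0 \<le> w t" for t by (simp add: w_def)
  have s: "0 < s" using pos by (simp add: s_def)
  \<comment> \<open>A single mass that is large enough for both plans in
    \<open>coupling_off_with_mass\<close>.\<close>
  obtain C where C0: "0 \<le> C"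
    and C: "emeasure \<mu> (- A) + emeasure \<nu> (- A) + emeasure \<rho> (- A) = ennreal C"
    using fin by (cases "emeasure \<mu> (- A) + emeasure \<nu> (- A) + emeasure \<rho> (- A)") auto
  have CP: "emeasure \<mu> (- A) + emeasure \<nu> (- A) \<le> ennreal C" unfolding C[symmetric] by simp
  have CQ: "emeasure \<nu> (- A) + emeasure \<rho> (- A) \<le> ennreal C"
    unfolding C[symmetric] by (simp add: add.assoc)
  obtain P' where P': "coupling_off A P' \<mu> \<nu>" "emeasure P' UNIV = ennreal C"
    and costP: "transport_cost p A P' = transport_cost p A P"
    by (rule coupling_off_with_mass[OF p A a P CP])
  obtain Q' where Q': "coupling_off A Q' \<nu> \<rho>" "emeasure Q' UNIV = ennreal C"
    and costQ: "transport_cost p A Q' = transport_cost p A Q"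
    by (rule coupling_off_with_mass[OF p A a Q CQ])
  have PB: "P' \<in> borel_measures" and QB: "Q' \<in> borel_measures"
    using P' Q' by (auto simp: coupling_off_def)
  \<comment> \<open>Chosen so that \<open>\<delta> powr p * C\<close> is at most
    \<open>\<eta> powr p\<close>, since the gap is integrated over a measure of mass
    \<open>C\<close>. The summand 1 keeps the denominator positive for \<open>C = 0\<close>.\<close>
  define \<delta> where "\<delta> = \<eta> / (C + 1) powr (1 / p)"
  have \<delta>: "0 < \<delta>" using pos C0 by (simp add: \<delta>_def)
  have "\<delta> powr p * C = \<eta> powr p * (C / (C + 1))"
    using pos C0 p by (simp add: \<delta>_def powr_divide powr_powr)
  also have "\<dots> \<le> \<eta> powr p" using C0 by (intro mult_right_le_one_le) auto
  finally have "w \<eta> * (\<delta> powr p * C) \<le> w \<eta> * \<eta> powr p" by (rule mult_left_mono[OF _ w0])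
  then have small: "w \<eta> * \<delta> powr p * C \<le> s powr (p - 1) * \<eta>"
    using powr_weight_mult_eq[OF pos(3) s] by (simp add: w_def mult.assoc)
  obtain I :: "'a \<Rightarrow> nat" where I: "I \<in> measurable borel (count_space UNIV)"
    and I0: "\<And>x. I x = 0 \<longleftrightarrow> x \<in> A" and Idp: "\<And>x y. I x = I y \<Longrightarrow> dp p A x y \<le> \<delta>"
    using small_cells[OF p A \<delta>] by blast
  have IB: "I -` {k} \<in> sets borel" for k using measurable_sets[OF I, of "{k}"] by simp
  have cA: "- A \<in> sets borel" using A by simp
  have mid: "emeasure P' (snd -` (- A)) = emeasure \<nu> (- A)" "emeasure Q' (fst -` (- A)) = emeasure \<nu> (- A)"
    using P'(1) Q'(1) cA by (simp_all add: coupling_off_def)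
  \<comment> \<open>A cell off \<open>A\<close> is measured by the common marginal \<nu>. The cell
    \<open>A\<close> is the complement of the others; both plans give it the mass \<open>C\<close>
    minus the finite mass of \<nu> off \<open>A\<close>.\<close>
  have cell: "emeasure P' ((I \<circ> snd) -` {k}) = emeasure Q' ((I \<circ> fst) -` {k})" for k
  proof (cases "k = 0")
    case False
    then have "I -` {k} \<subseteq> - A" by (auto simp flip: I0)
    then show ?thesis
      using P' Q' IB[of k] by (simp add: coupling_off_def vimage_comp[symmetric])
  next
    case True
    have "(I \<circ> (snd :: 'a \<times> 'a \<Rightarrow> 'a)) -` {k} = UNIV - snd -` (- A)"
      "(I \<circ> (fst :: 'a \<times> 'a \<Rightarrow> 'a)) -` {k} = UNIV - fst -` (- A)"
      using True by (auto simp flip: I0)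
    moreover have "emeasure P' (UNIV - snd -` (- A)) = emeasure P' UNIV - emeasure P' (snd -` (- A))"
      "emeasure Q' (UNIV - fst -` (- A)) = emeasure Q' UNIV - emeasure Q' (fst -` (- A))"
      using fin(2) by (subst emeasure_Diff; simp add: mid PB QB borel_vimage_fst_snd[OF cA])+
    ultimately show ?thesis by (simp only: P'(2) Q'(2) mid)
  qed
  have finP: "finite_measure P'" and finQ: "finite_measure Q'"
    using P'(2) Q'(2) PB QB by (auto intro!: finite_measureI)
  have u: "I \<circ> snd \<in> measurable P' (count_space UNIV)" and v: "I \<circ> fst \<in> measurable Q' (count_space UNIV)"
    by (rule measurable_borel_measures[OF PB] measurable_borel_measures[OF QB],
        rule measurable_comp[OF _ I], rule continuous_measurable_pair)+
  have cell': "emeasure P' ((I \<circ> snd) -` {k} \<inter> space P') = emeasure Q' ((I \<circ> fst) -` {k} \<inter> space Q')" for k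
    unfolding borel_measuresD(2)[OF PB] borel_measuresD(2)[OF QB] Int_UNIV_right by (rule cell)
  obtain G where sG: "sets G = sets (P' \<Otimes>\<^sub>M Q')"
    and G1: "\<And>f. f \<in> borel_measurable P' \<Longrightarrow> (\<integral>\<^sup>+z. f (fst z) \<partial>G) = (\<integral>\<^sup>+x. f x \<partial>P')"
    and G2: "\<And>f. f \<in> borel_measurable Q' \<Longrightarrow> (\<integral>\<^sup>+z. f (snd z) \<partial>G) = (\<integral>\<^sup>+x. f x \<partial>Q')"
    and GI: "AE z in G. (I \<circ> snd) (fst z) = (I \<circ> fst) (snd z)"
    by (rule glue_along_cells[OF finP finQ u v cell']) (rule that; simp)
  have [measurable_cong]: "sets G = sets (borel \<Otimes>\<^sub>M borel)"
    using sG PB QB by (simp cong: sets_pair_measure_cong)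
  \<comment> \<open>A point of \<open>G\<close> consists of two jumps ((x, y), (x', y')) with
    \<open>y\<close> and \<open>x'\<close> in the same cell; \<open>g\<close> keeps the outer
    ends.\<close>
  define g :: "('a \<times> 'a) \<times> ('a \<times> 'a) \<Rightarrow> 'a \<times> 'a" where "g z = (fst (fst z), snd (snd z))" for z
  have fs [measurable]: "(fst :: 'a \<times> 'a \<Rightarrow> 'a) \<in> measurable borel borel" "(snd :: 'a \<times> 'a \<Rightarrow> 'a) \<in> measurable borel borel"
    by (rule continuous_measurable_pair)+
  have g: "g \<in> measurable G borel"
    unfolding g_def borel_prod[symmetric, where ?'a = 'a and ?'b = 'a] by measurable
  have [measurable]: "(\<lambda>z. ennreal (dp p A (fst z) (snd z) powr p)) \<in> borel_measurable borel" by measurable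
  define R where "R = distr G borel g"
  show thesis
  proof
    show "coupling_off A R \<mu> \<rho>"
      unfolding coupling_off_def
    proof (intro conjI ballI impI)
      show "R \<in> borel_measures" by (simp add: R_def)
      fix E :: "'a set" assume E: "E \<in> sets borel" "E \<subseteq> - A"
      note FE = borel_vimage_fst_snd(1)[OF E(1), where ?'b = 'a] borel_vimage_fst_snd(2)[OF E(1), where ?'b = 'a]
      have R: "emeasure R F = (\<integral>\<^sup>+z. indicator F (g z) \<partial>G)" if "F \<in> sets borel" for F
        using that g by (simp add: R_def nn_integral_distr[symmetric] flip: nn_integral_indicator)
      have "emeasure R (fst -` E) = (\<integral>\<^sup>+z. indicator (fst -` E) (fst z) \<partial>G)"
        unfolding R[OF FE(1)] by (intro nn_integral_cong) (simp add: g_def indicator_def)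
      also have "\<dots> = emeasure P' (fst -` E)" using FE PB by (subst G1; intro borel_measurable_indicator nn_integral_indicator) simp_all
      also have "\<dots> = emeasure \<mu> E" using P' E by (simp add: coupling_off_def)
      finally show "emeasure R (fst -` E) = emeasure \<mu> E" .
      have "emeasure R (snd -` E) = (\<integral>\<^sup>+z. indicator (snd -` E) (snd z) \<partial>G)"
        unfolding R[OF FE(2)] by (intro nn_integral_cong) (simp add: g_def indicator_def)
      also have "\<dots> = emeasure Q' (snd -` E)" using FE QB by (subst G2; intro borel_measurable_indicator nn_integral_indicator) simp_all
      also have "\<dots> = emeasure \<rho> E" using Q' E by (simp add: coupling_off_def)
      finally show "emeasure R (snd -` E) = emeasure \<rho> E" .
    qed
    have pw: "ennreal (dp p A x y' powr p) \<le> ennreal (w \<alpha>) * ennreal (dp p A x y powr p)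
        + ennreal (w \<beta>) * ennreal (dp p A x' y' powr p) + ennreal (w \<eta> * \<delta> powr p)"
      if "dp p A y x' \<le> \<delta>" for x y x' y'
    proof -
      have "dp p A x y' \<le> dp p A x y + dp p A x' y' + \<delta>"
        using dp_triangle[OF p, of A x y' y] dp_triangle[OF p, of A y y' x'] that by simp
      then have "dp p A x y' powr p \<le> (dp p A x y + dp p A x' y' + \<delta>) powr p"
        using p by (intro powr_mono2) (auto simp: dp_nonneg)
      also have "\<dots> \<le> w \<alpha> * dp p A x y powr p + w \<beta> * dp p A x' y' powr p + w \<eta> * \<delta> powr p"
        unfolding w_def s_def using powr_add3_le_weighted[OF p _ _ _ pos] \<delta> by (simp add: dp_nonneg)
      finally show ?thesis
        using w0 by (simp add: ennreal_mult[symmetric] ennreal_plus[symmetric] ennreal_leI del: ennreal_plus)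
    qed
    let ?c = "\<lambda>z. ennreal (dp p A (fst z) (snd z) powr p)"
    have cm: "?c \<in> borel_measurable P'" "?c \<in> borel_measurable Q'"
      by (intro measurable_borel_measures[OF PB] measurable_borel_measures[OF QB], measurable)+
    have cG: "(\<lambda>z. ?c (fst z)) \<in> borel_measurable G" "(\<lambda>z. ?c (snd z)) \<in> borel_measurable G"
      by measurable
    have lin: "(\<integral>\<^sup>+z. b * f z + c * h z + d * 1 \<partial>G) = b * (\<integral>\<^sup>+z. f z \<partial>G) + c * (\<integral>\<^sup>+z. h z \<partial>G) + d * (\<integral>\<^sup>+z. 1 \<partial>G)"
      if [measurable]: "f \<in> borel_measurable G" "h \<in> borel_measurable G" for b c d f h
      by (simp add: nn_integral_add nn_integral_cmult)
    have mass: "(\<integral>\<^sup>+z. 1 \<partial>G) = ennreal C"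
      using G1[of "\<lambda>_. 1"] P'(2) PB by simp
    have "transport_cost p A R = (\<integral>\<^sup>+z. ?c (g z) \<partial>G)"
      unfolding transport_cost_def R_def using g by (subst nn_integral_distr) auto
    also have "\<dots> \<le> (\<integral>\<^sup>+z. ennreal (w \<alpha>) * ?c (fst z) + ennreal (w \<beta>) * ?c (snd z) + ennreal (w \<eta> * \<delta> powr p) * 1 \<partial>G)"
      using GI by (intro nn_integral_mono_AE, eventually_elim) (auto simp: g_def intro!: pw Idp)
    also have "\<dots> = ennreal (w \<alpha>) * (\<integral>\<^sup>+z. ?c (fst z) \<partial>G) + ennreal (w \<beta>) * (\<integral>\<^sup>+z. ?c (snd z) \<partial>G)
        + ennreal (w \<eta> * \<delta> powr p) * (\<integral>\<^sup>+z. 1 \<partial>G)"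
      by (rule lin[OF cG])
    also have "\<dots> = ennreal (w \<alpha>) * transport_cost p A P + ennreal (w \<beta>) * transport_cost p A Q
        + ennreal (w \<eta> * \<delta> powr p * C)"
      unfolding mass G1[OF cm(1)] G2[OF cm(2)] transport_cost_def[symmetric] costP costQ
      using C0 w0 by (simp add: ennreal_mult)
    also have "\<dots> \<le> ennreal (w \<alpha>) * transport_cost p A P + ennreal (w \<beta>) * transport_cost p A Q
        + ennreal (s powr (p - 1) * \<eta>)"
      using small by (intro add_left_mono ennreal_leI)
    finally show "transport_cost p A R \<le>
      ennreal ((s / \<alpha>) powr (p - 1)) * transport_cost p A P
      + ennreal ((s / \<beta>) powr (p - 1)) * transport_cost p A Q + ennreal (s powr (p - 1) * \<eta>)"
      by (simp add: w_def)
  qed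
qed

section \<open>From costs to the distance, and the triangle inequality\<close>

lemma ennreal_root_le:
  assumes "1 \<le> p" "0 \<le> s" "c \<le> ennreal (s powr p)"
  shows "ennreal_root p c \<le> ennreal s"
proof -
  have c: "c < \<top>" using assms(3) by (rule le_less_trans) simp
  then have "enn2real c \<le> s powr p"
    using enn2real_mono[OF assms(3)] by simp
  then have "enn2real c powr (1 / p) \<le> (s powr p) powr (1 / p)"
    using assms by (intro powr_mono2) auto
  also have "\<dots> = s" using assms by (simp add: powr_powr)
  finally show ?thesis using c by (auto simp: ennreal_root_def intro: ennreal_leI)
qed

lemma le_ennreal_root:
  assumes "1 \<le> p" "0 \<le> s" "ennreal (s powr p) \<le> c"
  shows "ennreal s \<le> ennreal_root p c"
proof (cases "c = \<top>")
  case False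
  then have "s powr p \<le> enn2real c"
    using enn2real_mono[OF assms(3)] by (simp add: less_top)
  then have "(s powr p) powr (1 / p) \<le> enn2real c powr (1 / p)"
    using assms by (intro powr_mono2) auto
  also have "(s powr p) powr (1 / p) = s" using assms by (simp add: powr_powr)
  finally show ?thesis using False by (auto simp: ennreal_root_def intro: ennreal_leI)
qed (simp add: ennreal_root_def)

lemma ennreal_root_lessD:
  assumes "1 \<le> p" "0 \<le> s" "ennreal_root p c < ennreal s"
  shows "c < ennreal (s powr p)"
  using le_ennreal_root[OF assms(1,2), of c] assms(3) by (meson leD not_le)

lemma ennreal_root_eq:
  assumes "1 \<le> p" "0 \<le> s" "c = ennreal (s powr p)"
  shows "ennreal_root p c = ennreal s"
  using ennreal_root_le[OF assms(1,2), of c] le_ennreal_root[OF assms(1,2), of c] assms(3) by simp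

lemma wcost_le:
  assumes "0 < \<epsilon>" "coupling_off A P (far_measure A \<epsilon> \<mu>) (far_measure A \<epsilon> \<nu>)"
  shows "wcost p A \<mu> \<nu> \<le> total_cost p A \<epsilon> \<mu> \<nu> P"
  unfolding wcost_def using assms by (intro INF_lower2[of \<epsilon>] INF_lower) auto

text \<open>Lowering the threshold moves a shell from the near parts into the coupling, where it
  costs its moment as before. Near-optimal couplings therefore exist at every smaller threshold, and
  two of them can be brought to a common one.\<close>

lemma wcost_lessE:
  fixes A :: "'a::polish_space set"
  assumes p: "1 \<le> p" and a: "a \<in> A" and \<mu>: "\<mu> \<in> borel_measures" and \<nu>: "\<nu> \<in> borel_measures"
    and less: "wcost p A \<mu> \<nu> < c"
  obtains \<epsilon>0 where "0 < \<epsilon>0" "\<And>\<epsilon>. 0 < \<epsilon> \<Longrightarrow> \<epsilon> \<le> \<epsilon>0 \<Longrightarrow>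
    \<exists>P. coupling_off A P (far_measure A \<epsilon> \<mu>) (far_measure A \<epsilon> \<nu>) \<and> total_cost p A \<epsilon> \<mu> \<nu> P < c"
proof -
  obtain t P where t: "0 < t" and P: "coupling_off A P (far_measure A t \<mu>) (far_measure A t \<nu>)"
    and c: "total_cost p A t \<mu> \<nu> P < c"
    using less by (auto simp: wcost_def INF_less_iff)
  have PB: "P \<in> borel_measures" using P by (simp add: coupling_off_def)
  show thesis
  proof (rule that[OF t])
    fix \<epsilon> assume \<epsilon>: "0 < \<epsilon>" "\<epsilon> \<le> t"
    have "total_cost p A \<epsilon> \<mu> \<nu> (extend_coupling A a \<epsilon> t \<mu> \<nu> P) = transport_cost p A P
      + (moment p A (shell_measure A 0 \<epsilon> \<mu>) + moment p A (shell_measure A \<epsilon> t \<mu>))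
      + (moment p A (shell_measure A 0 \<epsilon> \<nu>) + moment p A (shell_measure A \<epsilon> t \<nu>))"
      by (simp add: total_cost_def transport_cost_extend[OF p \<mu> \<nu> a PB] ac_simps)
    also have "\<dots> = total_cost p A t \<mu> \<nu> P"
      using \<epsilon> by (simp add: moment_shell_add \<mu> \<nu> total_cost_def)
    finally show "\<exists>P. coupling_off A P (far_measure A \<epsilon> \<mu>) (far_measure A \<epsilon> \<nu>) \<and> total_cost p A \<epsilon> \<mu> \<nu> P < c"
      using c coupling_off_extend[OF \<mu> \<nu> a \<epsilon>(2) P] by auto
  qed
qed

text \<open>Markov's inequality for d_A^p.\<close>

lemma far_measure_finite:
  fixes A :: "'a::metric_space set"
  assumes \<mu>: "\<mu> \<in> borel_measures" and m: "moment p A \<mu> < \<top>" and \<epsilon>: "0 < \<epsilon>" and A: "closed A" and p: "0 \<le> p"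
  shows "emeasure (far_measure A \<epsilon> \<mu>) (- A) < \<top>"
proof -
  let ?S = "{x. \<epsilon> < infdist x A}"
  have S: "?S \<in> sets \<mu>" using \<mu> shell_sets(1) by simp
  have "ennreal (\<epsilon> powr p) * emeasure \<mu> ?S = (\<integral>\<^sup>+x. ennreal (\<epsilon> powr p) * indicator ?S x \<partial>\<mu>)"
    using S by (simp add: nn_integral_cmult_indicator)
  also have "\<dots> \<le> moment p A \<mu>"
    unfolding moment_def
    by (intro nn_integral_mono) (use \<epsilon> p in \<open>auto simp: indicator_def intro!: ennreal_leI powr_mono2\<close>)
  finally have "ennreal (\<epsilon> powr p) * emeasure \<mu> ?S < \<top>" using m by (rule le_less_trans)
  then have "emeasure \<mu> ?S < \<top>" using \<epsilon> by (auto simp: ennreal_mult_less_top)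
  moreover have "emeasure (far_measure A \<epsilon> \<mu>) (- A) \<le> emeasure \<mu> ?S"
    using A S by (simp add: far_measure_def emeasure_far_shell[OF \<mu>] emeasure_mono)
  ultimately show ?thesis by (rule le_less_trans[rotated])
qed

text \<open>An error \<open>e\<close> is allowed and divided into three: two shares make \<alpha>
  and \<beta> strictly larger than the distances, so that couplings of cost below
  \<open>\<alpha> powr p\<close> and \<open>\<beta> powr p\<close> exist, and the third pays for the
  gluing.\<close>

lemma Wp_triangle:
  fixes A :: "'a::polish_space set"
  assumes p: "1 \<le> p" and A: "closed A" and a: "a \<in> A"
    and \<mu>: "\<mu> \<in> borel_measures" "moment p A \<mu> < \<top>"
    and \<nu>: "\<nu> \<in> borel_measures" "moment p A \<nu> < \<top>"
    and \<rho>: "\<rho> \<in> borel_measures" "moment p A \<rho> < \<top>"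
  shows "Wp p A a (rel_class A \<mu>) (rel_class A \<rho>)
    \<le> Wp p A a (rel_class A \<mu>) (rel_class A \<nu>) + Wp p A a (rel_class A \<nu>) (rel_class A \<rho>)"
proof (rule ennreal_le_epsilon)
  let ?W = "\<lambda>\<mu> \<nu>. Wp p A a (rel_class A \<mu>) (rel_class A \<nu>)"
  fix e :: real
  assume "?W \<mu> \<nu> + ?W \<nu> \<rho> < \<top>" and e: "0 < e"
  then obtain u v where u: "?W \<mu> \<nu> = ennreal u" "0 \<le> u" and v: "?W \<nu> \<rho> = ennreal v" "0 \<le> v"
    by (cases "?W \<mu> \<nu>"; cases "?W \<nu> \<rho>") auto
  \<comment> \<open>The weights \<open>(s / t) powr (p - 1)\<close> for \<open>t = \<alpha>, \<beta>, \<eta>\<close> make the weighted pointwise inequality as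
      sharp as Minkowski's.\<close>
  define \<alpha> \<beta> \<eta> where "\<alpha> = u + e / 3" and "\<beta> = v + e / 3" and "\<eta> = e / 3"
  define s where "s = \<alpha> + \<beta> + \<eta>"
  have pos: "0 < \<alpha>" "0 < \<beta>" "0 < \<eta>" "0 < s"
    using u v e by (auto simp: \<alpha>_def \<beta>_def \<eta>_def s_def)
  have "ennreal_root p (wcost p A \<mu> \<nu>) < ennreal \<alpha>" "ennreal_root p (wcost p A \<nu> \<rho>) < ennreal \<beta>"
    unfolding Wp_class[OF p A a \<mu>(1) \<nu>(1), symmetric] Wp_class[OF p A a \<nu>(1) \<rho>(1), symmetric] u v
    using u v e by (auto simp: \<alpha>_def \<beta>_def intro!: ennreal_lessI)
  then have less: "wcost p A \<mu> \<nu> < ennreal (\<alpha> powr p)" "wcost p A \<nu> \<rho> < ennreal (\<beta> powr p)"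
    using ennreal_root_lessD[OF p] pos by auto
  obtain t1 where t1: "0 < t1" "\<And>\<epsilon>. 0 < \<epsilon> \<Longrightarrow> \<epsilon> \<le> t1 \<Longrightarrow>
    \<exists>P. coupling_off A P (far_measure A \<epsilon> \<mu>) (far_measure A \<epsilon> \<nu>) \<and> total_cost p A \<epsilon> \<mu> \<nu> P < ennreal (\<alpha> powr p)"
    by (rule wcost_lessE[OF p a \<mu>(1) \<nu>(1) less(1)]) blast
  obtain t2 where t2: "0 < t2" "\<And>\<epsilon>. 0 < \<epsilon> \<Longrightarrow> \<epsilon> \<le> t2 \<Longrightarrow>
    \<exists>P. coupling_off A P (far_measure A \<epsilon> \<nu>) (far_measure A \<epsilon> \<rho>) \<and> total_cost p A \<epsilon> \<nu> \<rho> P < ennreal (\<beta> powr p)"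
    by (rule wcost_lessE[OF p a \<nu>(1) \<rho>(1) less(2)]) blast
  define \<epsilon> where "\<epsilon> = min t1 t2"
  have \<epsilon>: "0 < \<epsilon>" "\<epsilon> \<le> t1" "\<epsilon> \<le> t2" using t1 t2 by (auto simp: \<epsilon>_def)
  obtain P where P: "coupling_off A P (far_measure A \<epsilon> \<mu>) (far_measure A \<epsilon> \<nu>)"
    and Pc: "total_cost p A \<epsilon> \<mu> \<nu> P < ennreal (\<alpha> powr p)"
    using t1(2)[OF \<epsilon>(1,2)] by blast
  obtain Q where Q: "coupling_off A Q (far_measure A \<epsilon> \<nu>) (far_measure A \<epsilon> \<rho>)"
    and Qc: "total_cost p A \<epsilon> \<nu> \<rho> Q < ennreal (\<beta> powr p)"
    using t2(2)[OF \<epsilon>(1,3)] by blast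
  have fin: "emeasure (far_measure A \<epsilon> \<mu>) (- A) < \<top>" "emeasure (far_measure A \<epsilon> \<nu>) (- A) < \<top>"
    "emeasure (far_measure A \<epsilon> \<rho>) (- A) < \<top>"
    using far_measure_finite[OF \<mu> \<epsilon>(1) A] far_measure_finite[OF \<nu> \<epsilon>(1) A] far_measure_finite[OF \<rho> \<epsilon>(1) A] p
    by simp_all
  define b where "b t = (s / t) powr (p - 1)" for t
  have b1: "1 \<le> b \<alpha>" "1 \<le> b \<beta>"
    using pos p by (auto simp: b_def s_def intro!: ge_one_powr_ge_zero)
  obtain R where R: "coupling_off A R (far_measure A \<epsilon> \<mu>) (far_measure A \<epsilon> \<rho>)"
    and Rc: "transport_cost p A R \<le> ennreal (b \<alpha>) * transport_cost p A P
      + ennreal (b \<beta>) * transport_cost p A Q + ennreal (s powr (p - 1) * \<eta>)"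
    unfolding b_def s_def by (rule coupling_off_triangle[OF p A a P Q fin pos(1-3)])
  let ?m = "\<lambda>\<mu>. moment p A (shell_measure A 0 \<epsilon> \<mu>)"
  \<comment> \<open>The weights are at least 1, so the near-part moments of the outer measures can
    be absorbed into the weighted total costs.\<close>
  have "?m \<mu> \<le> ennreal (b \<alpha>) * ?m \<mu>" "?m \<rho> \<le> ennreal (b \<beta>) * ?m \<rho>"
    using mult_right_mono[of 1 "ennreal (b \<alpha>)" "?m \<mu>"] mult_right_mono[of 1 "ennreal (b \<beta>)" "?m \<rho>"] b1
    by (simp_all add: ennreal_ge_1)
  then have "total_cost p A \<epsilon> \<mu> \<rho> R \<le> (ennreal (b \<alpha>) * transport_cost p A P
      + ennreal (b \<beta>) * transport_cost p A Q + ennreal (s powr (p - 1) * \<eta>))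
      + ennreal (b \<alpha>) * ?m \<mu> + ennreal (b \<beta>) * ?m \<rho>"
    unfolding total_cost_def using Rc by (intro add_mono)
  also have "\<dots> = ennreal (b \<alpha>) * (transport_cost p A P + ?m \<mu>)
      + ennreal (b \<beta>) * (transport_cost p A Q + ?m \<rho>) + ennreal (s powr (p - 1) * \<eta>)"
    by (simp add: distrib_left ac_simps)
  \<comment> \<open>The near-part moment of the middle measure is added to both brackets to complete
    them to total costs.\<close>
  also have "\<dots> \<le> ennreal (b \<alpha>) * total_cost p A \<epsilon> \<mu> \<nu> P
      + ennreal (b \<beta>) * total_cost p A \<epsilon> \<nu> \<rho> Q + ennreal (s powr (p - 1) * \<eta>)"
    by (intro add_mono mult_left_mono order_refl) (simp_all add: total_cost_def add_increasing2 ac_simps)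
  also have "\<dots> \<le> ennreal (b \<alpha>) * ennreal (\<alpha> powr p)
      + ennreal (b \<beta>) * ennreal (\<beta> powr p) + ennreal (s powr (p - 1) * \<eta>)"
    using Pc Qc by (intro add_mono mult_left_mono order_refl) auto
  also have "\<dots> = ennreal (b \<alpha> * \<alpha> powr p + b \<beta> * \<beta> powr p + s powr (p - 1) * \<eta>)"
    using b1 pos by (simp add: ennreal_mult)
  also have "b \<alpha> * \<alpha> powr p + b \<beta> * \<beta> powr p + s powr (p - 1) * \<eta> = s powr (p - 1) * s"
    using pos by (simp add: b_def powr_weight_mult_eq s_def distrib_left)
  also have "\<dots> = s powr p" using powr_add[of s "p - 1" 1] pos by simp
  finally have "wcost p A \<mu> \<rho> \<le> ennreal (s powr p)"
    using wcost_le[OF \<epsilon>(1) R, of p] by (rule order_trans[rotated])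
  then have "?W \<mu> \<rho> \<le> ennreal s"
    unfolding Wp_class[OF p A a \<mu>(1) \<rho>(1)] using pos by (intro ennreal_root_le[OF p]) auto
  also have "ennreal s = ?W \<mu> \<nu> + ?W \<nu> \<rho> + ennreal e"
    unfolding u v using u v e by (simp add: s_def \<alpha>_def \<beta>_def \<eta>_def flip: ennreal_plus)
  finally show "?W \<mu> \<rho> \<le> ?W \<mu> \<nu> + ?W \<nu> \<rho> + ennreal e" .
qed

section \<open>Finiteness, vanishing self-distance and symmetry\<close>

lemma moment_density_le:
  assumes "\<mu> \<in> borel_measures" "S \<in> sets borel"
  shows "moment p A (density \<mu> (indicator S)) \<le> moment p A \<mu>"
  unfolding moment_density[OF assms] unfolding moment_def
  by (intro nn_integral_mono) (auto simp: indicator_def)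

text \<open>Sending all mass to \<open>a\<close> is admissible, here at the threshold 1, and its
  cost is controlled by the moments.\<close>

lemma wcost_finite:
  fixes A :: "'a::polish_space set"
  assumes p: "1 \<le> p" and a: "a \<in> A"
    and \<mu>: "\<mu> \<in> borel_measures" "moment p A \<mu> < \<top>"
    and \<nu>: "\<nu> \<in> borel_measures" "moment p A \<nu> < \<top>"
  shows "wcost p A \<mu> \<nu> < \<top>"
proof -
  let ?\<mu> = "far_measure A 1 \<mu>" and ?\<nu> = "far_measure A 1 \<nu>"
  let ?P = "add_measure (distr ?\<mu> borel (\<lambda>x. (x, a))) (distr ?\<nu> borel (\<lambda>x. (a, x)))"
  have far: "?\<mu> \<in> borel_measures" "?\<nu> \<in> borel_measures" using \<mu> \<nu> by simp_all
  have em: "emeasure ?P E = emeasure ?\<mu> ((\<lambda>x. (x, a)) -` E) + emeasure ?\<nu> ((\<lambda>x. (a, x)) -` E)"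
    if "E \<in> sets borel" for E
    using that far by (simp add: emeasure_add_measure emeasure_distr measurable_borel_measures continuous_measurable_pair)
  have "coupling_off A ?P ?\<mu> ?\<nu>"
    unfolding coupling_off_def
  proof (intro conjI ballI impI)
    fix E assume E: "E \<in> sets borel" "E \<subseteq> - A"
    then have "a \<notin> E" using a by auto
    then have *: "(\<lambda>x. (x, a)) -` (fst -` E) = E" "(\<lambda>x. (a, x)) -` (fst -` E) = {}"
      "(\<lambda>x. (x, a)) -` (snd -` E) = {}" "(\<lambda>x. (a, x)) -` (snd -` E) = E" by auto
    show "emeasure ?P (fst -` E) = emeasure ?\<mu> E" "emeasure ?P (snd -` E) = emeasure ?\<nu> E"
      using em[OF borel_vimage_fst_snd(1)[OF E(1)]] em[OF borel_vimage_fst_snd(2)[OF E(1)]]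
      unfolding * by simp_all
  qed simp
  then have "wcost p A \<mu> \<nu> \<le> total_cost p A 1 \<mu> \<nu> ?P" by (intro wcost_le) auto
  also have "transport_cost p A ?P = moment p A ?\<mu> + moment p A ?\<nu>"
    unfolding transport_cost_def moment_def using p a far
    by (simp add: nn_integral_add_measure nn_integral_distr measurable_borel_measures
        continuous_measurable_pair dp_eq_infdist)
  then have "total_cost p A 1 \<mu> \<nu> ?P \<le> moment p A \<mu> + moment p A \<nu> + moment p A \<mu> + moment p A \<nu>"
    unfolding total_cost_def far_measure_def shell_measure_def
    using \<mu>(1) \<nu>(1) by (simp add: add_mono moment_density_le shell_sets)
  also have "\<dots> < \<top>" using \<mu>(2) \<nu>(2) by simp
  finally show ?thesis .
qed

text \<open>The far part is coupled with itself along the diagonal at no cost, while the near part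
  is sent to \<open>A\<close> twice. Its moment tends to 0 with the threshold by dominated
  convergence, which uses the finite moment.\<close>

lemma wcost_self:
  fixes A :: "'a::polish_space set"
  assumes p: "1 \<le> p" and \<mu>: "\<mu> \<in> borel_measures" "moment p A \<mu> < \<top>"
  shows "wcost p A \<mu> \<mu> = 0"
proof -
  define r :: "nat \<Rightarrow> real" where "r n = 1 / real (Suc n)" for n
  have r: "0 < r n" for n by (simp add: r_def)
  have diag: "(\<lambda>x::'a. (x, x)) \<in> measurable borel borel"
    by (intro borel_measurable_continuous_onI continuous_intros)
  have self: "dp p A x x = 0" for x by (simp add: dp_def)
  have le: "wcost p A \<mu> \<mu> \<le> 2 * moment p A (shell_measure A 0 (r n) \<mu>)" for n
  proof -
    let ?P = "distr (far_measure A (r n) \<mu>) borel (\<lambda>x. (x, x))"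
    have "coupling_off A ?P (far_measure A (r n) \<mu>) (far_measure A (r n) \<mu>)"
      unfolding coupling_off_def
    proof (intro conjI ballI impI)
      fix E :: "'a set" assume E: "E \<in> sets borel"
      have *: "(\<lambda>x. (x, x)) -` (fst -` E) = E" "(\<lambda>x. (x, x)) -` (snd -` E) = E" by auto
      show "emeasure ?P (fst -` E) = emeasure (far_measure A (r n) \<mu>) E"
        "emeasure ?P (snd -` E) = emeasure (far_measure A (r n) \<mu>) E"
        using \<mu>(1) E by (simp_all add: emeasure_distr measurable_borel_measures[OF _ diag] borel_vimage_fst_snd *)
    qed simp
    then have "wcost p A \<mu> \<mu> \<le> total_cost p A (r n) \<mu> \<mu> ?P" by (rule wcost_le[OF r])
    also have "transport_cost p A ?P = 0"
      unfolding transport_cost_def using \<mu>(1)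
      by (subst nn_integral_distr) (simp_all add: measurable_borel_measures[OF _ diag] self)
    then have "total_cost p A (r n) \<mu> \<mu> ?P = 2 * moment p A (shell_measure A 0 (r n) \<mu>)"
      by (simp add: total_cost_def mult_2)
    finally show ?thesis .
  qed
  have "(\<lambda>n. \<integral>\<^sup>+x. ennreal (infdist x A powr p) * indicator {x. 0 < infdist x A \<and> infdist x A \<le> r n} x \<partial>\<mu>)
      \<longlonglongrightarrow> (\<integral>\<^sup>+x. 0 \<partial>\<mu>)"
  proof (rule nn_integral_dominated_convergence[where w = "\<lambda>x. ennreal (infdist x A powr p)"])
    show "(\<integral>\<^sup>+x. ennreal (infdist x A powr p) \<partial>\<mu>) < \<infinity>" using \<mu>(2) by (simp add: moment_def)
    show "AE x in \<mu>. (\<lambda>n. ennreal (infdist x A powr p) * indicator {x. 0 < infdist x A \<and> infdist x A \<le> r n} x) \<longlonglongrightarrow> 0"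
    proof (rule AE_I2)
      fix x
      have "\<forall>\<^sub>F n in sequentially. ennreal (infdist x A powr p) * indicator {x. 0 < infdist x A \<and> infdist x A \<le> r n} x = 0"
      proof (cases "0 < infdist x A")
        case True
        have "r \<longlonglongrightarrow> 0" unfolding r_def by (rule LIMSEQ_Suc[OF lim_1_over_n])
        then have "\<forall>\<^sub>F n in sequentially. r n < infdist x A" using True by (rule order_tendstoD)
        then show ?thesis by eventually_elim (simp add: indicator_def)
      qed simp
      then show "(\<lambda>n. ennreal (infdist x A powr p) * indicator {x. 0 < infdist x A \<and> infdist x A \<le> r n} x) \<longlonglongrightarrow> 0"
        by (rule tendsto_eventually)
    qed
  qed (use \<mu> in \<open>auto simp: indicator_def intro!: measurable_borel_measures[OF \<mu>(1)]\<close>)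
  then have "(\<lambda>n. moment p A (shell_measure A 0 (r n) \<mu>)) \<longlonglongrightarrow> 0"
    unfolding shell_measure_def moment_density[OF \<mu>(1) shell_sets(2)] by simp
  then have "(\<lambda>n. 2 * moment p A (shell_measure A 0 (r n) \<mu>)) \<longlonglongrightarrow> 2 * 0"
    by (intro tendsto_mult_ennreal) auto
  then have "wcost p A \<mu> \<mu> \<le> 2 * 0" using le by (intro LIMSEQ_le_const) auto
  then show ?thesis by simp
qed

lemma wcost_commute_le:
  fixes A :: "'a::polish_space set"
  assumes \<mu>: "\<mu> \<in> borel_measures" and \<nu>: "\<nu> \<in> borel_measures"
  shows "wcost p A \<nu> \<mu> \<le> wcost p A \<mu> \<nu>"
  unfolding wcost_def[of p A \<mu> \<nu>]
proof (intro INF_greatest)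
  fix \<epsilon> :: real and P
  assume \<epsilon>: "\<epsilon> \<in> {0<..}" and "P \<in> {P. coupling_off A P (far_measure A \<epsilon> \<mu>) (far_measure A \<epsilon> \<nu>)}"
  then have P: "coupling_off A P (far_measure A \<epsilon> \<mu>) (far_measure A \<epsilon> \<nu>)" by simp
  have PB: "P \<in> borel_measures" using P by (simp add: coupling_off_def)
  let ?s = "\<lambda>z::'a \<times> 'a. (snd z, fst z)"
  have s: "?s \<in> measurable P borel"
    by (intro measurable_borel_measures[OF PB] borel_measurable_continuous_onI continuous_intros)
  let ?Q = "distr P borel ?s"
  have "coupling_off A ?Q (far_measure A \<epsilon> \<nu>) (far_measure A \<epsilon> \<mu>)"
    unfolding coupling_off_def
  proof (intro conjI ballI impI)
    fix E :: "'a set" assume E: "E \<in> sets borel" "E \<subseteq> - A"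
    have "?s -` (fst -` E) = snd -` E" "?s -` (snd -` E) = fst -` E" by auto
    then show "emeasure ?Q (fst -` E) = emeasure (far_measure A \<epsilon> \<nu>) E"
      "emeasure ?Q (snd -` E) = emeasure (far_measure A \<epsilon> \<mu>) E"
      using P E PB s by (simp_all add: emeasure_distr borel_vimage_fst_snd coupling_off_def)
  qed simp
  then have "wcost p A \<nu> \<mu> \<le> total_cost p A \<epsilon> \<nu> \<mu> ?Q" using \<epsilon> by (intro wcost_le) auto
  also have "transport_cost p A ?Q = transport_cost p A P"
    unfolding transport_cost_def using s by (subst nn_integral_distr) (simp_all add: dp_commute)
  then have "total_cost p A \<epsilon> \<nu> \<mu> ?Q = total_cost p A \<epsilon> \<mu> \<nu> P"
    by (simp add: total_cost_def ac_simps)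
  finally show "wcost p A \<nu> \<mu> \<le> total_cost p A \<epsilon> \<mu> \<nu> P" .
qed

section \<open>Distances between Dirac measures\<close>

text \<open>This is the easy half of Kantorovich duality: a sum of one-variable potentials below the
  cost on almost all pairs is integrated against \<open>P\<close>, which involves only the
  marginals.\<close>

lemma transport_cost_dirac_ge:
  fixes A :: "'a::polish_space set"
  assumes p: "1 \<le> p" and A: "closed A" and P: "coupling_off A P (return borel x) (return borel y)"
  shows "ennreal (dp p A x y powr p) \<le> transport_cost p A P"
proof -
  define d where "d = dp p A x y powr p"
  \<comment> \<open>The dual potentials are the point masses \<open>c1\<close> at \<open>x\<close> and \<open>c2\<close> at \<open>y\<close>, with \<open>c1 + c2 = d\<close>.\<close>
  define c1 where "c1 = min d (infdist x A powr p)"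
  define c2 where "c2 = d - c1"
  \<comment> \<open>The route through \<open>A\<close> bounds \<open>d\<close>, so what
    \<open>c1\<close> leaves over is at most d_A(y)^p.\<close>
  have d: "d \<le> infdist x A powr p + infdist y A powr p" using p by (simp add: d_def dp_powr)
  have d0: "0 \<le> d" by (simp add: d_def)
  have c: "0 \<le> c1" "0 \<le> c2" "c1 + c2 = d" "c1 \<le> infdist x A powr p" "c2 \<le> infdist y A powr p"
    using d d0 by (auto simp: c1_def c2_def min_def)
  have PB: "P \<in> borel_measures" using P by (simp add: coupling_off_def)
  \<comment> \<open>The marginal at \<open>x\<close> is known only off \<open>A\<close>; for
    \<open>x\<close> in \<open>A\<close> the potential \<open>c1\<close> vanishes, as recorded in
    \<open>zero\<close>.\<close>
  have one: "emeasure P (fst -` {x}) = 1" if "x \<notin> A" using P that by (simp add: coupling_off_def)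
  have two: "emeasure P (snd -` {y}) = 1" if "y \<notin> A" using P that by (simp add: coupling_off_def)
  have zero: "c1 = 0" if "x \<in> A" using c that p by simp
  have zero': "c2 = 0" if "y \<in> A" using c that p by simp
  have sx: "fst -` {x} \<in> sets P" "snd -` {y} \<in> sets P"
    using borel_vimage_fst_snd[of "{x}"] borel_vimage_fst_snd[of "{y}"] PB by simp_all
  have S: "- A - {x} \<in> sets borel" "- A - {y} \<in> sets borel" using A by auto
  have null: "fst -` (- A - {x}) \<in> null_sets P" "snd -` (- A - {y}) \<in> null_sets P"
    using P S PB borel_vimage_fst_snd[OF S(1)] borel_vimage_fst_snd[OF S(2)]
    by (auto simp: null_sets_def coupling_off_def)
  \<comment> \<open>Off \<open>A\<close> the marginals are point masses, so almost every pair starts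
    in \<open>A\<close> or at \<open>x\<close> and ends in \<open>A\<close> or at
    \<open>y\<close>.\<close>
  have ae: "AE z in P. fst z \<in> A \<union> {x}" "AE z in P. snd z \<in> A \<union> {y}"
    using AE_not_in[OF null(1)] AE_not_in[OF null(2)] by (elim eventually_mono; auto)+
  have pw: "c1 * indicator {x} u + c2 * indicator {y} v \<le> dp p A u v powr p"
    if "u \<in> A \<union> {x}" "v \<in> A \<union> {y}" for u v
  proof -
    consider "u = x" "v = y" | "u = x" "v \<noteq> y" "v \<in> A" | "u \<noteq> x" "u \<in> A" "v = y" | "u \<noteq> x" "v \<noteq> y"
      using \<open>u \<in> A \<union> {x}\<close> \<open>v \<in> A \<union> {y}\<close> by blast
    then show ?thesis
    proof cases
      case 1
      then show ?thesis using c by (simp add: d_def)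
    next
      case 2
      then show ?thesis using c p by (simp add: dp_eq_infdist)
    next
      case 3
      then show ?thesis using c p by (simp add: dp_eq_infdist)
    qed simp
  qed
  have "ennreal d = ennreal c1 * emeasure P (fst -` {x}) + ennreal c2 * emeasure P (snd -` {y})"
    using c one two zero zero' by (cases "x \<in> A"; cases "y \<in> A") (auto simp flip: ennreal_plus)
  also have "\<dots> = (\<integral>\<^sup>+z. ennreal c1 * indicator (fst -` {x}) z + ennreal c2 * indicator (snd -` {y}) z \<partial>P)"
    using sx by (simp add: nn_integral_add nn_integral_cmult_indicator)
  also have "\<dots> \<le> transport_cost p A P"
    unfolding transport_cost_def
  proof (intro nn_integral_mono_AE, use ae in eventually_elim)
    fix z assume "fst z \<in> A \<union> {x}" "snd z \<in> A \<union> {y}"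
    then have "ennreal (c1 * indicator {x} (fst z) + c2 * indicator {y} (snd z)) \<le> ennreal (dp p A (fst z) (snd z) powr p)"
      by (intro ennreal_leI pw)
    then show "ennreal c1 * indicator (fst -` {x}) z + ennreal c2 * indicator (snd -` {y}) z
        \<le> ennreal (dp p A (fst z) (snd z) powr p)"
      using c by (cases "fst z = x"; cases "snd z = y") (auto simp flip: ennreal_plus)
  qed
  finally show ?thesis by (simp add: d_def)
qed

lemma return_borel_measures [simp]: "return borel x \<in> borel_measures"
  unfolding borel_measures_def by simp

text \<open>The upper bound comes from the point mass at (x, y), taken at a threshold below the
  positive distances to \<open>A\<close>; the lower bound is \<open>transport_cost_dirac_ge\<close>
  for the extended coupling.\<close>

lemma wcost_dirac:
  fixes A :: "'a::polish_space set"
  assumes p: "1 \<le> p" and A: "closed A" and a: "a \<in> A"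
  shows "wcost p A (return borel x) (return borel y) = ennreal (dp p A x y powr p)"
proof (rule antisym)
  have ne: "A \<noteq> {}" using a by blast
  \<comment> \<open>Each of \<open>x\<close> and \<open>y\<close> then lies in the far part or in
    \<open>A\<close>, so the near parts have zero moment. The value 1 stands in for a point of
    \<open>A\<close>, which imposes no bound.\<close>
  define \<epsilon> where "\<epsilon> = min (if infdist x A = 0 then 1 else infdist x A / 2) (if infdist y A = 0 then 1 else infdist y A / 2)"
  have \<epsilon>: "0 < \<epsilon>" using infdist_nonneg[of x A] infdist_nonneg[of y A] by (auto simp: \<epsilon>_def)
  have far: "infdist z A = 0 \<or> \<epsilon> < infdist z A" if "z \<in> {x, y}" for z
    using that infdist_nonneg[of x A] infdist_nonneg[of y A] by (auto simp: \<epsilon>_def min_def)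
  have em: "emeasure (far_measure A \<epsilon> (return borel z)) E = indicator E z"
    if "z \<in> {x, y}" "E \<in> sets borel" "E \<subseteq> - A" for z E
  proof -
    have "z \<in> E \<Longrightarrow> \<epsilon> < infdist z A"
      using far[OF that(1)] that(3) infdist_pos_not_in_closed[OF A ne, of z] by fastforce
    then show ?thesis
      using that(2) shell_sets(1)[of \<epsilon> A]
      by (simp add: far_measure_def emeasure_far_shell) (auto simp: indicator_def)
  qed
  have near: "moment p A (shell_measure A 0 \<epsilon> (return borel z)) = 0" if "z \<in> {x, y}" for z
    unfolding shell_measure_def moment_density[OF return_borel_measures shell_sets(2)]
    using far[OF that] by (subst nn_integral_return) (auto simp: indicator_def)
  let ?P = "return borel (x, y)"
  have "coupling_off A ?P (far_measure A \<epsilon> (return borel x)) (far_measure A \<epsilon> (return borel y))"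
    unfolding coupling_off_def using em by (auto simp: borel_vimage_fst_snd indicator_def)
  then have "wcost p A (return borel x) (return borel y) \<le> total_cost p A \<epsilon> (return borel x) (return borel y) ?P"
    by (rule wcost_le[OF \<epsilon>])
  also have "\<dots> = ennreal (dp p A x y powr p)"
    using near by (simp add: total_cost_def transport_cost_def nn_integral_return)
  finally show "wcost p A (return borel x) (return borel y) \<le> ennreal (dp p A x y powr p)" .
next
  show "ennreal (dp p A x y powr p) \<le> wcost p A (return borel x) (return borel y)"
    unfolding wcost_def
  proof (intro INF_greatest)
    fix \<epsilon> :: real and P
    let ?x = "return borel x" and ?y = "return borel y"
    assume \<epsilon>: "\<epsilon> \<in> {0<..}" and "P \<in> {P. coupling_off A P (far_measure A \<epsilon> ?x) (far_measure A \<epsilon> ?y)}"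
    then have P: "coupling_off A P (far_measure A \<epsilon> ?x) (far_measure A \<epsilon> ?y)" by simp
    then have PB: "P \<in> borel_measures" by (simp add: coupling_off_def)
    \<comment> \<open>At the threshold 0 the extension couples the Dirac measures themselves, and
      its transport cost is the total cost of \<open>P\<close>.\<close>
    have "coupling_off A (extend_coupling A a 0 \<epsilon> ?x ?y P) (far_measure A 0 ?x) (far_measure A 0 ?y)"
      using \<epsilon> P a by (intro coupling_off_extend) auto
    moreover have "coupling_off A R (far_measure A 0 ?x) (far_measure A 0 ?y) \<longleftrightarrow> coupling_off A R ?x ?y" for R
      using a by (intro coupling_off_cong emeasure_far_zero[OF A]) auto
    ultimately have "ennreal (dp p A x y powr p) \<le> transport_cost p A (extend_coupling A a 0 \<epsilon> ?x ?y P)"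
      by (intro transport_cost_dirac_ge[OF p A]) blast
    also have "\<dots> = total_cost p A \<epsilon> ?x ?y P"
      using a PB by (simp add: transport_cost_extend[OF p] total_cost_def)
    finally show "ennreal (dp p A x y powr p) \<le> total_cost p A \<epsilon> ?x ?y P" .
  qed
qed

lemma rel_dirac_in_Mp:
  fixes A :: "'a::polish_space set"
  assumes p: "1 \<le> p" and A: "closed A"
  shows "rel_dirac A x \<in> Mp p A"
proof -
  have em: "rel_emeasure (rel_dirac A x) E = indicator E x" if "E \<in> sets borel" "E \<subseteq> - A" for E
    unfolding rel_dirac_def using that by (subst rel_emeasure_class[OF A]) auto
  have "rel_emeasure (rel_dirac A x) E = (SUP K\<in>{K. compact K \<and> K \<subseteq> E}. rel_emeasure (rel_dirac A x) K)"
    if E: "E \<in> sets borel" "E \<subseteq> - A" for E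
  proof -
    have K: "rel_emeasure (rel_dirac A x) K = indicator K x" if "compact K" "K \<subseteq> E" for K
      using that E by (intro em) (auto intro: borel_compact)
    have "(SUP K\<in>{K. compact K \<and> K \<subseteq> E}. rel_emeasure (rel_dirac A x) K)
        = (SUP K\<in>{K. compact K \<and> K \<subseteq> E}. indicator K x)"
      using K by (intro SUP_cong) auto
    also have "\<dots> = indicator E x"
    proof (rule antisym)
      show "(SUP K\<in>{K. compact K \<and> K \<subseteq> E}. indicator K x) \<le> (indicator E x :: ennreal)"
        by (intro SUP_least) (auto simp: indicator_def)
      \<comment> \<open>The compact set \<open>E \<inter> {x}\<close>, empty or a single point,
        already attains the supremum.\<close>
      have "indicator E x \<le> (indicator (E \<inter> {x}) x :: ennreal)" by (auto simp: indicator_def)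
      also have "\<dots> \<le> (SUP K\<in>{K. compact K \<and> K \<subseteq> E}. indicator K x)"
        by (intro SUP_upper) (auto intro: finite_imp_compact)
      finally show "indicator E x \<le> (SUP K\<in>{K. compact K \<and> K \<subseteq> E}. indicator K x :: ennreal)" .
    qed
    finally show ?thesis using em[OF E] by simp
  qed
  then have "rel_tight A (rel_dirac A x)" by (simp add: rel_tight_def)
  moreover have "rel_integral (rel_dirac A x) (\<lambda>x. ennreal (infdist x A powr p)) < \<top>"
    unfolding rel_dirac_def using p by (subst rel_integral_class[OF A]) (auto simp: nn_integral_return)
  moreover have "rel_dirac A x \<in> rel_measures A"
    unfolding rel_dirac_def by (rule rel_class_in_rel_measures) simp
  ultimately show ?thesis by (simp add: Mp_def)
qed

section \<open>Relative measures of finite moment as a pseudometric space\<close>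

lemma MpE:
  assumes p: "1 \<le> p" and A: "closed A" and M: "M \<in> Mp p A"
  obtains \<mu> where "\<mu> \<in> borel_measures" "moment p A \<mu> < \<top>" "M = rel_class A \<mu>"
proof -
  obtain \<mu> where \<mu>: "\<mu> \<in> borel_measures" "M = rel_class A \<mu>"
    using M by (auto simp: Mp_def elim: rel_measuresE)
  moreover have "rel_integral (rel_class A \<mu>) (\<lambda>x. ennreal (infdist x A powr p)) = moment p A \<mu>"
    unfolding moment_def using p by (intro rel_integral_class[OF A \<mu>(1)]) auto
  ultimately show thesis using M that by (simp add: Mp_def)
qed

theorem theorem6p36:
  fixes A :: "'a::polish_space set" and p :: real and a :: 'a
  assumes "closed A" and "A \<noteq> {}" and "1 \<le> p" and "a \<in> A"
  shows "pseudometric_on (Mp p A) (Wp p A a)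
    \<and> (\<forall>x. rel_dirac A x \<in> Mp p A)
    \<and> (\<forall>x y. Wp p A a (rel_dirac A x) (rel_dirac A y) = ennreal (dp p A x y))"
proof (intro conjI allI)
  note A = assms(1) and p = assms(3) and a = assms(4)
  show "pseudometric_on (Mp p A) (Wp p A a)"
    unfolding pseudometric_on_def
  proof (intro conjI ballI)
    fix M N assume MN: "M \<in> Mp p A" "N \<in> Mp p A"
    obtain \<mu> where \<mu>: "\<mu> \<in> borel_measures" "moment p A \<mu> < \<top>" and M: "M = rel_class A \<mu>"
      by (rule MpE[OF p A MN(1)])
    obtain \<nu> where \<nu>: "\<nu> \<in> borel_measures" "moment p A \<nu> < \<top>" and N: "N = rel_class A \<nu>"
      by (rule MpE[OF p A MN(2)])
    show "Wp p A a M N < \<top>"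
      using wcost_finite[OF p a \<mu> \<nu>] unfolding M N Wp_class[OF p A a \<mu>(1) \<nu>(1)]
      by (auto simp: ennreal_root_def)
    show "Wp p A a M N = Wp p A a N M"
      using antisym[OF wcost_commute_le[OF \<nu>(1) \<mu>(1), of p A] wcost_commute_le[OF \<mu>(1) \<nu>(1), of p A]]
      unfolding M N Wp_class[OF p A a \<mu>(1) \<nu>(1)] Wp_class[OF p A a \<nu>(1) \<mu>(1)] by simp
    show "Wp p A a M M = 0"
      unfolding M Wp_class[OF p A a \<mu>(1) \<mu>(1)] wcost_self[OF p \<mu>] using p by (simp add: ennreal_root_def)
    fix L assume L: "L \<in> Mp p A"
    obtain \<rho> where \<rho>: "\<rho> \<in> borel_measures" "moment p A \<rho> < \<top>" and L: "L = rel_class A \<rho>"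
      by (rule MpE[OF p A L])
    show "Wp p A a M L \<le> Wp p A a M N + Wp p A a N L"
      unfolding M N L by (rule Wp_triangle[OF p A a \<mu> \<nu> \<rho>])
  qed
  show "rel_dirac A x \<in> Mp p A" for x by (rule rel_dirac_in_Mp[OF p A])
  show "Wp p A a (rel_dirac A x) (rel_dirac A y) = ennreal (dp p A x y)" for x y
    unfolding rel_dirac_def Wp_class[OF p A a return_borel_measures return_borel_measures]
      wcost_dirac[OF p A a]
    by (rule ennreal_root_eq[OF p dp_nonneg refl])
qed

end
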